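(* Let $S$ be a commutative local ring, and let $V$ be a free $S$-module of rank $2m$ ($m\ge1$) with a nondegenerate alternating bilinear form $h:V\times V\to S$ having a symplectic basis. Let $\mathfrak i$ be a proper ideal of $S$, $\tilde S=S/\mathfrak i$, $\tilde V=V/\mathfrak iV$ with the induced alternating form $\tilde h$. Then the reduction homomorphism $\pi:Sp(V)\to Sp(\tilde V)$, $X\mapsto\tilde X$, is surjective. (It is not assumed that $2\in S^\times$.)
   Context: $Sp(V)$ is the group of $S$-linear automorphisms of $V$ preserving $h$, and $Sp(\tilde V)$ is the group of $\tilde S$-linear automorphisms of $\tilde V$ preserving $\tilde h$. A basis $u_1,v_1,\dots,u_m,v_m$ of $V$ is symplectic if $h(u_i,v_i)=1$ for all $i$, $h(u_i,u_j)=h(v_i,v_j)=0$ for all $i,j$, and $h(u_i,v_j)=0$ for $i\ne j$. Here $\tilde h(\tilde u,\tilde v)=h(u,v)+\mathfrak i$, where $\tilde u$ denotes the image of $u\in V$ in $\tilde V$, and $\tilde X$ is defined by $\tilde X\tilde u=\widetilde{Xu}$. *)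

theory Defs
  imports "HOL-Algebra.Bij" "HOL-Algebra.Generated_Groups" "HOL-Algebra.Module" "HOL-Algebra.QuotRing"
begin

section \<open>Local rings, free modules and bilinear forms\<close>

locale local_ring = cring R for R (structure) +
  assumes unique_maximalideal: "\<exists>!M. maximalideal M R"

definition module_basis ::
    "('a, 'r) ring_scheme \<Rightarrow> ('a, 'v, 'w) module_scheme \<Rightarrow> 'i set \<Rightarrow> ('i \<Rightarrow> 'v) \<Rightarrow> bool"
  where "module_basis R M J b \<longleftrightarrow>
    finite J \<and> b \<in> J \<rightarrow> carrier M \<and>
    (\<forall>x \<in> carrier M. \<exists>c \<in> J \<rightarrow> carrier R. x = (\<Oplus>\<^bsub>M\<^esub>j\<in>J. c j \<odot>\<^bsub>M\<^esub> b j)) \<and>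
    (\<forall>c \<in> J \<rightarrow> carrier R. (\<Oplus>\<^bsub>M\<^esub>j\<in>J. c j \<odot>\<^bsub>M\<^esub> b j) = \<zero>\<^bsub>M\<^esub> \<longrightarrow> (\<forall>j\<in>J. c j = \<zero>\<^bsub>R\<^esub>))"

definition free_of_rank ::
    "('a, 'r) ring_scheme \<Rightarrow> ('a, 'v, 'w) module_scheme \<Rightarrow> nat \<Rightarrow> bool"
  where "free_of_rank R M n \<longleftrightarrow> (\<exists>b. module_basis R M {..<n} b)"

definition mod_hom ::
    "('a, 'r) ring_scheme \<Rightarrow> ('a, 'v, 'w) module_scheme \<Rightarrow> ('a, 'u, 'z) module_scheme \<Rightarrow> ('v \<Rightarrow> 'u) set"
  where "mod_hom R M N = {f \<in> carrier M \<rightarrow> carrier N.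
    (\<forall>x \<in> carrier M. \<forall>y \<in> carrier M. f (x \<oplus>\<^bsub>M\<^esub> y) = f x \<oplus>\<^bsub>N\<^esub> f y) \<and>
    (\<forall>a \<in> carrier R. \<forall>x \<in> carrier M. f (a \<odot>\<^bsub>M\<^esub> x) = a \<odot>\<^bsub>N\<^esub> f x)}"

definition dual_module ::
    "('a, 'r) ring_scheme \<Rightarrow> ('a, 'v, 'w) module_scheme \<Rightarrow> ('v \<Rightarrow> 'a) set"
  where "dual_module R M = {f \<in> carrier M \<rightarrow>\<^sub>E carrier R.
    (\<forall>x \<in> carrier M. \<forall>y \<in> carrier M. f (x \<oplus>\<^bsub>M\<^esub> y) = f x \<oplus>\<^bsub>R\<^esub> f y) \<and>
    (\<forall>a \<in> carrier R. \<forall>x \<in> carrier M. f (a \<odot>\<^bsub>M\<^esub> x) = a \<otimes>\<^bsub>R\<^esub> f x)}"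

definition bilinear_form ::
    "('a, 'r) ring_scheme \<Rightarrow> ('a, 'v, 'w) module_scheme \<Rightarrow> ('v \<Rightarrow> 'v \<Rightarrow> 'a) \<Rightarrow> bool"
  where "bilinear_form R M h \<longleftrightarrow>
    (\<forall>x \<in> carrier M. \<forall>y \<in> carrier M. h x y \<in> carrier R) \<and>
    (\<forall>x \<in> carrier M. \<forall>y \<in> carrier M. \<forall>z \<in> carrier M.
      h (x \<oplus>\<^bsub>M\<^esub> y) z = h x z \<oplus>\<^bsub>R\<^esub> h y z \<and> h x (y \<oplus>\<^bsub>M\<^esub> z) = h x y \<oplus>\<^bsub>R\<^esub> h x z) \<and>
    (\<forall>a \<in> carrier R. \<forall>x \<in> carrier M. \<forall>y \<in> carrier M.
      h (a \<odot>\<^bsub>M\<^esub> x) y = a \<otimes>\<^bsub>R\<^esub> h x y \<and> h x (a \<odot>\<^bsub>M\<^esub> y) = a \<otimes>\<^bsub>R\<^esub> h x y)"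

definition alternating_form ::
    "('a, 'r) ring_scheme \<Rightarrow> ('a, 'v, 'w) module_scheme \<Rightarrow> ('v \<Rightarrow> 'v \<Rightarrow> 'a) \<Rightarrow> bool"
  where "alternating_form R M h \<longleftrightarrow> bilinear_form R M h \<and> (\<forall>x \<in> carrier M. h x x = \<zero>\<^bsub>R\<^esub>)"

text \<open>Over a ring, nondegeneracy is taken in the strong sense that \<open>M\<close> is mapped isomorphically
  onto its dual.\<close>

definition nondegenerate_form ::
    "('a, 'r) ring_scheme \<Rightarrow> ('a, 'v, 'w) module_scheme \<Rightarrow> ('v \<Rightarrow> 'v \<Rightarrow> 'a) \<Rightarrow> bool"
  where "nondegenerate_form R M h \<longleftrightarrow>
    bij_betw (\<lambda>x. \<lambda>y \<in> carrier M. h x y) (carrier M) (dual_module R M)"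

definition symplectic_basis ::
    "('a, 'r) ring_scheme \<Rightarrow> ('a, 'v, 'w) module_scheme \<Rightarrow> ('v \<Rightarrow> 'v \<Rightarrow> 'a) \<Rightarrow>
      nat \<Rightarrow> (nat \<Rightarrow> 'v) \<Rightarrow> (nat \<Rightarrow> 'v) \<Rightarrow> bool"
  where "symplectic_basis R M h m u v \<longleftrightarrow>
    module_basis R M (Sum_Type.Plus {1..m} {1..m}) (case_sum u v) \<and>
    (\<forall>i \<in> {1..m}. h (u i) (v i) = \<one>\<^bsub>R\<^esub>) \<and>
    (\<forall>i \<in> {1..m}. \<forall>j \<in> {1..m}. h (u i) (u j) = \<zero>\<^bsub>R\<^esub> \<and> h (v i) (v j) = \<zero>\<^bsub>R\<^esub>) \<and>
    (\<forall>i \<in> {1..m}. \<forall>j \<in> {1..m}. i \<noteq> j \<longrightarrow> h (u i) (v j) = \<zero>\<^bsub>R\<^esub>)"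

definition Sp ::
    "('a, 'r) ring_scheme \<Rightarrow> ('a, 'v, 'w) module_scheme \<Rightarrow> ('v \<Rightarrow> 'v \<Rightarrow> 'a) \<Rightarrow> ('v \<Rightarrow> 'v) monoid"
  where "Sp R M h = BijGroup (carrier M)
    \<lparr>carrier := {g \<in> Bij (carrier M) \<inter> mod_hom R M M.
      \<forall>x \<in> carrier M. \<forall>y \<in> carrier M. h (g x) (g y) = h x y}\<rparr>"


section \<open>Reduction modulo an ideal\<close>

definition ideal_smult ::
    "'a set \<Rightarrow> ('a, 'v, 'w) module_scheme \<Rightarrow> 'v set"
  where "ideal_smult I M = generate (add_monoid M) {a \<odot>\<^bsub>M\<^esub> x |a x. a \<in> I \<and> x \<in> carrier M}"

text \<open>The module \<open>M / IM\<close> over \<open>R Quot I\<close>. As in \<^const>\<open>FactRing\<close>, elements are additive cosets, and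
  operations are unions over representatives; all cosets in such a union coincide (see below).
  The fields \<open>mult\<close> and \<open>one\<close> of the record play no role for modules.\<close>

definition red_module ::
    "'a set \<Rightarrow> ('a, 'v, 'w) module_scheme \<Rightarrow> ('a set, 'v set) module"
  where "red_module I M =
    \<lparr>carrier = a_rcosets\<^bsub>M\<^esub> (ideal_smult I M), mult = undefined, one = undefined,
     zero = ideal_smult I M, add = set_add M,
     smult = (\<lambda>A B. \<Union>a\<in>A. \<Union>x\<in>B. ideal_smult I M +>\<^bsub>M\<^esub> (a \<odot>\<^bsub>M\<^esub> x))\<rparr>"

definition red_form ::
    "('a, 'r) ring_scheme \<Rightarrow> 'a set \<Rightarrow> ('v \<Rightarrow> 'v \<Rightarrow> 'a) \<Rightarrow> 'v set \<Rightarrow> 'v set \<Rightarrow> 'a set"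
  where "red_form R I h A B = (\<Union>x\<in>A. \<Union>y\<in>B. I +>\<^bsub>R\<^esub> h x y)"

definition red_map ::
    "'a set \<Rightarrow> ('a, 'v, 'w) module_scheme \<Rightarrow> ('v \<Rightarrow> 'v) \<Rightarrow> 'v set \<Rightarrow> 'v set"
  where "red_map I M g = (\<lambda>A \<in> carrier (red_module I M). \<Union>x\<in>A. ideal_smult I M +>\<^bsub>M\<^esub> g x)"


subsection \<open>The reductions are well defined\<close>

lemma UN2_eqI:
  assumes "a \<in> A" "b \<in> B" "\<And>x y. x \<in> A \<Longrightarrow> y \<in> B \<Longrightarrow> F x y = C"
  shows "(\<Union>x\<in>A. \<Union>y\<in>B. F x y) = C"
  using assms by blast

context module
begin

context
  fixes I
  assumes I: "ideal I R"
begin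

interpretation I: ideal I R by (rule I)

lemma ideal_gens_closed: "{a \<odot>\<^bsub>M\<^esub> x |a x. a \<in> I \<and> x \<in> carrier M} \<subseteq> carrier M"
  using I.Icarr by auto

lemma ideal_smult_subgroup: "subgroup (ideal_smult I M) (add_monoid M)"
  unfolding ideal_smult_def
  by (rule add.generate_is_subgroup) (use ideal_gens_closed in simp)

lemma ideal_smult_abelian_subgroup: "abelian_subgroup (ideal_smult I M) M"
  by (rule abelian_subgroupI3)
    (auto intro: additive_subgroup.intro ideal_smult_subgroup M.abelian_group_axioms)

interpretation N: abelian_subgroup "ideal_smult I M" M
  by (rule ideal_smult_abelian_subgroup)

lemma ideal_smultI: "a \<in> I \<Longrightarrow> x \<in> carrier M \<Longrightarrow> a \<odot>\<^bsub>M\<^esub> x \<in> ideal_smult I M"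
  unfolding ideal_smult_def by (rule generate.incl) auto

lemma additive_image_ideal_smult:
  assumes f: "f \<in> carrier M \<rightarrow> carrier G" "\<And>x y. x \<in> carrier M \<Longrightarrow> y \<in> carrier M \<Longrightarrow>
      f (x \<oplus>\<^bsub>M\<^esub> y) = f x \<oplus>\<^bsub>G\<^esub> f y"
    and G: "abelian_group G" "additive_subgroup H G"
    and gen: "\<And>a x. a \<in> I \<Longrightarrow> x \<in> carrier M \<Longrightarrow> f (a \<odot>\<^bsub>M\<^esub> x) \<in> H"
    and x: "x \<in> ideal_smult I M"
  shows "f x \<in> H"
proof -
  interpret G: abelian_group G by fact
  interpret H: additive_subgroup H G by fact
  have hom: "group_hom (add_monoid M) (add_monoid G) f"
    using f by (intro group_hom.intro group_hom_axioms.intro M.add.is_group G.add.is_group homI) auto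
  interpret f: group_hom "add_monoid M" "add_monoid G" f by (rule hom)
  have "f ` ideal_smult I M = generate (add_monoid G)
      (f ` {a \<odot>\<^bsub>M\<^esub> x |a x. a \<in> I \<and> x \<in> carrier M})"
    unfolding ideal_smult_def by (rule f.generate_img[symmetric]) (use ideal_gens_closed in simp)
  also have "\<dots> \<subseteq> H"
    by (rule G.add.generate_subgroup_incl) (use gen H.a_subgroup in auto)
  finally show ?thesis using x by blast
qed

lemma smult_ideal_smult:
  assumes "a \<in> carrier R" "x \<in> ideal_smult I M"
  shows "a \<odot>\<^bsub>M\<^esub> x \<in> ideal_smult I M"
proof (rule additive_image_ideal_smult[where G = M, OF _ _ _ _ _ assms(2)])
  show "a \<odot>\<^bsub>M\<^esub> (b \<odot>\<^bsub>M\<^esub> y) \<in> ideal_smult I M" if "b \<in> I" "y \<in> carrier M" for b y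
    using that assms I.Icarr[of b] smult_assoc1[of a b y, symmetric]
    by (simp add: ideal_smultI I.I_l_closed)
qed (use assms in \<open>auto simp: smult_r_distr M.abelian_group_axioms N.additive_subgroup_axioms\<close>)

lemma mod_hom_ideal_smult:
  assumes "g \<in> mod_hom R M M" "x \<in> ideal_smult I M"
  shows "g x \<in> ideal_smult I M"
proof (rule additive_image_ideal_smult[where G = M, OF _ _ _ _ _ assms(2)])
  show "g (b \<odot>\<^bsub>M\<^esub> y) \<in> ideal_smult I M" if "b \<in> I" "y \<in> carrier M" for b y
    using that assms I.Icarr[of b] by (auto simp: mod_hom_def intro!: ideal_smultI)
qed (use assms in \<open>auto simp: mod_hom_def M.abelian_group_axioms N.additive_subgroup_axioms\<close>)

lemma form_ideal_smult:
  assumes h: "bilinear_form R M h" and x: "x \<in> ideal_smult I M" and y: "y \<in> carrier M"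
  shows "h x y \<in> I" "h y x \<in> I"
proof -
  show "h x y \<in> I"
    by (rule additive_image_ideal_smult[where G = R and f = "\<lambda>x. h x y", OF _ _ _ _ _ x])
      (use h y in \<open>auto simp: bilinear_form_def R.abelian_group_axioms I.additive_subgroup_axioms
        I.I_r_closed dest: I.Icarr\<close>)
  show "h y x \<in> I"
    by (rule additive_image_ideal_smult[where G = R and f = "h y", OF _ _ _ _ _ x])
      (use h y in \<open>auto simp: bilinear_form_def R.abelian_group_axioms I.additive_subgroup_axioms
        I.I_r_closed dest: I.Icarr\<close>)
qed

lemma red_carrier:
  "carrier (red_module I M) = (\<lambda>x. ideal_smult I M +>\<^bsub>M\<^esub> x) ` carrier M"
  unfolding red_module_def by (auto simp: A_RCOSETS_def' )

lemma mem_red_coset: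
  assumes "x \<in> carrier M" "y \<in> ideal_smult I M +>\<^bsub>M\<^esub> x"
  obtains n where "n \<in> ideal_smult I M" "y = n \<oplus>\<^bsub>M\<^esub> x"
  using assms by (auto simp: a_r_coset_def')

lemma red_coset_eqI:
  assumes "x \<in> carrier M" "n \<in> ideal_smult I M"
  shows "ideal_smult I M +>\<^bsub>M\<^esub> (n \<oplus>\<^bsub>M\<^esub> x) = ideal_smult I M +>\<^bsub>M\<^esub> x"
proof -
  have "n \<oplus>\<^bsub>M\<^esub> x \<in> ideal_smult I M +>\<^bsub>M\<^esub> x" using assms by (auto simp: a_r_coset_def')
  then show ?thesis using assms N.a_subgroup M.a_repr_independence by metis
qed

lemma red_smult_coset:
  assumes a: "a \<in> carrier R" and x: "x \<in> carrier M"
  shows "(I +>\<^bsub>R\<^esub> a) \<odot>\<^bsub>red_module I M\<^esub> (ideal_smult I M +>\<^bsub>M\<^esub> x) = ideal_smult I M +>\<^bsub>M\<^esub> (a \<odot>\<^bsub>M\<^esub> x)"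
proof -
  have *: "ideal_smult I M +>\<^bsub>M\<^esub> (b \<odot>\<^bsub>M\<^esub> y) = ideal_smult I M +>\<^bsub>M\<^esub> (a \<odot>\<^bsub>M\<^esub> x)"
    if b: "b \<in> I +>\<^bsub>R\<^esub> a" and y: "y \<in> ideal_smult I M +>\<^bsub>M\<^esub> x" for b y
  proof -
    obtain i where i: "i \<in> I" "b = i \<oplus> a" using b by (auto simp: a_r_coset_def')
    obtain n where n: "n \<in> ideal_smult I M" "y = n \<oplus>\<^bsub>M\<^esub> x" using mem_red_coset[OF x y] .
    have c: "i \<in> carrier R" "n \<in> carrier M" using i n I.Icarr N.a_Hcarr by auto
    have "b \<odot>\<^bsub>M\<^esub> y = (i \<odot>\<^bsub>M\<^esub> (n \<oplus>\<^bsub>M\<^esub> x) \<oplus>\<^bsub>M\<^esub> a \<odot>\<^bsub>M\<^esub> n) \<oplus>\<^bsub>M\<^esub> a \<odot>\<^bsub>M\<^esub> x"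
    proof -
      have "y \<in> carrier M" unfolding n(2) using c x by simp
      then have "b \<odot>\<^bsub>M\<^esub> y = i \<odot>\<^bsub>M\<^esub> y \<oplus>\<^bsub>M\<^esub> a \<odot>\<^bsub>M\<^esub> y"
        unfolding i(2) using c a by (intro smult_l_distr)
      moreover have "a \<odot>\<^bsub>M\<^esub> y = a \<odot>\<^bsub>M\<^esub> n \<oplus>\<^bsub>M\<^esub> a \<odot>\<^bsub>M\<^esub> x"
        unfolding n(2) using c a x by (intro smult_r_distr)
      ultimately have "b \<odot>\<^bsub>M\<^esub> y = i \<odot>\<^bsub>M\<^esub> y \<oplus>\<^bsub>M\<^esub> (a \<odot>\<^bsub>M\<^esub> n \<oplus>\<^bsub>M\<^esub> a \<odot>\<^bsub>M\<^esub> x)" by simp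
      also have "\<dots> = (i \<odot>\<^bsub>M\<^esub> y \<oplus>\<^bsub>M\<^esub> a \<odot>\<^bsub>M\<^esub> n) \<oplus>\<^bsub>M\<^esub> a \<odot>\<^bsub>M\<^esub> x"
        using \<open>y \<in> carrier M\<close> c a x by (intro M.a_assoc[symmetric]) auto
      finally show ?thesis unfolding n(2) .
    qed
    moreover have "i \<odot>\<^bsub>M\<^esub> (n \<oplus>\<^bsub>M\<^esub> x) \<oplus>\<^bsub>M\<^esub> a \<odot>\<^bsub>M\<^esub> n \<in> ideal_smult I M"
      using i(1) n(1) c a x by (intro N.a_closed ideal_smultI[of i] smult_ideal_smult) simp_all
    ultimately show ?thesis using a x by (simp add: red_coset_eqI)
  qed
  have "a \<in> I +>\<^bsub>R\<^esub> a" "x \<in> ideal_smult I M +>\<^bsub>M\<^esub> x"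
    using a x by (auto simp: I.a_rcos_self N.a_rcos_self)
  then show ?thesis using UN2_eqI[OF _ _ *] by (simp add: red_module_def)
qed

lemma red_add_coset:
  assumes "x \<in> carrier M" "y \<in> carrier M"
  shows "(ideal_smult I M +>\<^bsub>M\<^esub> x) \<oplus>\<^bsub>red_module I M\<^esub> (ideal_smult I M +>\<^bsub>M\<^esub> y)
    = ideal_smult I M +>\<^bsub>M\<^esub> (x \<oplus>\<^bsub>M\<^esub> y)"
  using assms by (simp add: red_module_def N.a_rcos_sum)

lemma red_map_coset:
  assumes g: "g \<in> mod_hom R M M" and x: "x \<in> carrier M"
  shows "red_map I M g (ideal_smult I M +>\<^bsub>M\<^esub> x) = ideal_smult I M +>\<^bsub>M\<^esub> g x"
proof -
  have *: "ideal_smult I M +>\<^bsub>M\<^esub> g y = ideal_smult I M +>\<^bsub>M\<^esub> g x"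
    if y: "y \<in> ideal_smult I M +>\<^bsub>M\<^esub> x" for y
  proof -
    obtain n where n: "n \<in> ideal_smult I M" "y = n \<oplus>\<^bsub>M\<^esub> x" using mem_red_coset[OF x y] .
    have "g y = g n \<oplus>\<^bsub>M\<^esub> g x" "g x \<in> carrier M"
      using g n x N.a_Hcarr by (auto simp: mod_hom_def)
    then show ?thesis using g n by (simp add: red_coset_eqI mod_hom_ideal_smult)
  qed
  have "x \<in> ideal_smult I M +>\<^bsub>M\<^esub> x" using x by (simp add: N.a_rcos_self)
  then have "(\<Union>y\<in>ideal_smult I M +>\<^bsub>M\<^esub> x. ideal_smult I M +>\<^bsub>M\<^esub> g y) = ideal_smult I M +>\<^bsub>M\<^esub> g x"
    using * by blast
  then show ?thesis using x by (simp add: red_map_def red_carrier)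
qed

lemma red_form_coset:
  assumes h: "bilinear_form R M h" and x: "x \<in> carrier M" and y: "y \<in> carrier M"
  shows "red_form R I h (ideal_smult I M +>\<^bsub>M\<^esub> x) (ideal_smult I M +>\<^bsub>M\<^esub> y) = I +>\<^bsub>R\<^esub> h x y"
proof -
  have *: "I +>\<^bsub>R\<^esub> h x' y' = I +>\<^bsub>R\<^esub> h x y"
    if x': "x' \<in> ideal_smult I M +>\<^bsub>M\<^esub> x" and y': "y' \<in> ideal_smult I M +>\<^bsub>M\<^esub> y" for x' y'
  proof -
    obtain n where n: "n \<in> ideal_smult I M" "x' = n \<oplus>\<^bsub>M\<^esub> x" using mem_red_coset[OF x x'] .
    obtain k where k: "k \<in> ideal_smult I M" "y' = k \<oplus>\<^bsub>M\<^esub> y" using mem_red_coset[OF y y'] .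
    have c: "n \<in> carrier M" "k \<in> carrier M" "k \<oplus>\<^bsub>M\<^esub> y \<in> carrier M" using n k y N.a_Hcarr by auto
    have H: "h n (k \<oplus>\<^bsub>M\<^esub> y) \<in> I" "h x k \<in> I"
      using form_ideal_smult[OF h] n k c x by auto
    have "h x' y' = h n (k \<oplus>\<^bsub>M\<^esub> y) \<oplus> (h x k \<oplus> h x y)"
    proof -
      have "h x' y' = h n y' \<oplus> h x y'" "h x y' = h x k \<oplus> h x y"
        using h c x y unfolding n(2) k(2) bilinear_form_def by blast+
      then show ?thesis using k by simp
    qed
    also have "\<dots> = (h n (k \<oplus>\<^bsub>M\<^esub> y) \<oplus> h x k) \<oplus> h x y"
      using h c x y by (intro R.a_assoc[symmetric]) (auto simp: bilinear_form_def)
    finally have "h x' y' \<in> I +>\<^bsub>R\<^esub> h x y"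
      using H by (auto simp: a_r_coset_def')
    then show ?thesis using h x y I.a_subgroup
      by (metis R.a_repr_independence bilinear_form_def)
  qed
  have "x \<in> ideal_smult I M +>\<^bsub>M\<^esub> x" "y \<in> ideal_smult I M +>\<^bsub>M\<^esub> y"
    using x y by (auto simp: N.a_rcos_self)
  then show ?thesis using UN2_eqI[OF _ _ *] by (simp add: red_form_def)
qed

lemma red_module_is_module: "module (R Quot I) (red_module I M)"
proof (rule moduleI)
  show "cring (R Quot I)" by (rule I.quotient_is_cring[OF R.cring_axioms])
  have zero: "\<zero>\<^bsub>red_module I M\<^esub> = ideal_smult I M +>\<^bsub>M\<^esub> \<zero>\<^bsub>M\<^esub>"
    using M.a_coset_join2[OF M.zero_closed N.a_subgroup N.zero_closed] by (simp add: red_module_def)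
  show "abelian_group (red_module I M)"
  proof (rule abelian_groupI)
    show "\<exists>B \<in> carrier (red_module I M). B \<oplus>\<^bsub>red_module I M\<^esub> A = \<zero>\<^bsub>red_module I M\<^esub>"
      if A: "A \<in> carrier (red_module I M)" for A
    proof -
      obtain x where x: "x \<in> carrier M" "A = ideal_smult I M +>\<^bsub>M\<^esub> x"
        using A by (auto simp: red_carrier)
      show ?thesis
        by (rule bexI[of _ "ideal_smult I M +>\<^bsub>M\<^esub> (\<ominus>\<^bsub>M\<^esub> x)"])
          (use x in \<open>auto simp: red_carrier zero red_add_coset M.l_neg\<close>)
    qed
  qed (auto simp: red_carrier zero red_add_coset M.a_ac)
next
  note carr = red_carrier FactRing_def A_RCOSETS_def'
  have mult: "(I +> a) \<otimes>\<^bsub>R Quot I\<^esub> (I +> b) = I +> (a \<otimes> b)"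
    if "a \<in> carrier R" "b \<in> carrier R" for a b
    using that by (simp add: FactRing_def I.rcoset_mult_add)
  have add: "(I +> a) \<oplus>\<^bsub>R Quot I\<^esub> (I +> b) = I +> (a \<oplus> b)"
    if "a \<in> carrier R" "b \<in> carrier R" for a b
    using that by (simp add: FactRing_def I.a_rcos_sum)
  have R: "carrier (R Quot I) = (\<lambda>a. I +> a) ` carrier R" by (auto simp: carr)
  have one: "\<one>\<^bsub>R Quot I\<^esub> = I +> \<one>" by (simp add: FactRing_def)
  note simps = mult add one red_smult_coset red_add_coset
  show "A \<odot>\<^bsub>red_module I M\<^esub> B \<in> carrier (red_module I M)"
    if "A \<in> carrier (R Quot I)" "B \<in> carrier (red_module I M)" for A B
    using that by (auto simp: R red_carrier simps)
  show "(A \<oplus>\<^bsub>R Quot I\<^esub> B) \<odot>\<^bsub>red_module I M\<^esub> C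
      = A \<odot>\<^bsub>red_module I M\<^esub> C \<oplus>\<^bsub>red_module I M\<^esub> B \<odot>\<^bsub>red_module I M\<^esub> C"
    if "A \<in> carrier (R Quot I)" "B \<in> carrier (R Quot I)" "C \<in> carrier (red_module I M)" for A B C
    using that by (auto simp: R red_carrier simps smult_l_distr)
  show "A \<odot>\<^bsub>red_module I M\<^esub> (B \<oplus>\<^bsub>red_module I M\<^esub> C)
      = A \<odot>\<^bsub>red_module I M\<^esub> B \<oplus>\<^bsub>red_module I M\<^esub> A \<odot>\<^bsub>red_module I M\<^esub> C"
    if "A \<in> carrier (R Quot I)" "B \<in> carrier (red_module I M)" "C \<in> carrier (red_module I M)" for A B C
    using that by (auto simp: R red_carrier simps smult_r_distr)
  show "(A \<otimes>\<^bsub>R Quot I\<^esub> B) \<odot>\<^bsub>red_module I M\<^esub> C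
      = A \<odot>\<^bsub>red_module I M\<^esub> (B \<odot>\<^bsub>red_module I M\<^esub> C)"
    if "A \<in> carrier (R Quot I)" "B \<in> carrier (R Quot I)" "C \<in> carrier (red_module I M)" for A B C
    using that by (auto simp: R red_carrier simps smult_assoc1)
  show "\<one>\<^bsub>R Quot I\<^esub> \<odot>\<^bsub>red_module I M\<^esub> A = A" if "A \<in> carrier (red_module I M)" for A
    using that by (auto simp: R red_carrier simps)
qed

end

end

end

theory Submission
  imports "HOL-Algebra.Ring_Divisibility" Defs
begin

text \<open>Given \<open>g\<close> in the symplectic group of \<open>V/IV\<close> and a symplectic basis \<open>u\<^sub>i, v\<^sub>i\<close> of \<open>V\<close>, choose
  representatives in \<open>V\<close> of the images under \<open>g\<close> of the classes of the \<open>u\<^sub>i, v\<^sub>i\<close>. They satisfy the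
  symplectic relations modulo \<open>I\<close>, and a Gram-Schmidt process makes the relations exact without
  changing the classes (\<open>lift_symplectic_system\<close>): subtracting from a new pair its projection to
  the pairs already found moves it by an element of \<open>IV\<close>, since the coefficients of the projection
  lie in \<open>I\<close>; the form then takes on the new pair a value in \<open>1 + I\<close>, and dividing by it is
  possible because \<open>S\<close> is local and \<open>I\<close> proper. As the form is alternating, no division by two is
  involved.

  The linear map \<open>X\<close> that carries \<open>u\<^sub>i, v\<^sub>i\<close> to the corrected representatives \<open>u\<^sub>i', v\<^sub>i'\<close> is an
  isometry and reduces to \<open>g\<close>. It is injective because the form is nondegenerate. It is surjective
  by Nakayama's lemma, since \<open>g\<close> is surjective and hence \<open>V = X(V) + IV\<close>; this avoids any use of
  determinants. So \<open>X\<close> lies in the symplectic group of \<open>V\<close> and is a preimage of \<open>g\<close>.\<close>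

section \<open>Units in a local ring\<close>

lemma (in cring) proper_ideal_in_maximalideal:
  assumes I: "ideal I R" and proper: "I \<noteq> carrier R"
  obtains M where "maximalideal M R" "I \<subseteq> M"
proof -
  \<comment> \<open>Properness is written as \<open>\<one> \<notin> J\<close>, a condition that passes to unions of chains.\<close>
  define A where "A = {J. ideal J R \<and> \<one> \<notin> J \<and> I \<subseteq> J}"
  have "\<exists>M\<in>A. \<forall>J\<in>A. M \<subseteq> J \<longrightarrow> J = M"
  proof (rule subset_Zorn_nonempty)
    show "A \<noteq> {}" using I proper ideal.one_imp_carrier by (auto simp: A_def)
    fix C assume C: "C \<noteq> {}" "subset.chain A C"
    then have "subset.chain {I. ideal I R} C" "\<forall>J\<in>C. I \<subseteq> J \<and> \<one> \<notin> J"
      unfolding pred_on.chain_def A_def by auto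
    then show "\<Union>C \<in> A"
      using chain_Union_is_ideal[of C] C(1) by (auto simp: A_def)
  qed
  then obtain M where M: "M \<in> A" "\<And>J. J \<in> A \<Longrightarrow> M \<subseteq> J \<Longrightarrow> J = M" by blast
  have "maximalideal M R"
  proof (rule maximalidealI)
    show "ideal M R" "carrier R \<noteq> M" using M(1) by (auto simp: A_def)
    fix J assume J: "ideal J R" "M \<subseteq> J" "J \<subseteq> carrier R"
    then have "\<one> \<notin> J \<Longrightarrow> J \<in> A" using M(1) by (auto simp: A_def)
    then show "J = M \<or> J = carrier R" using J M(2) ideal.one_imp_carrier by blast
  qed
  then show ?thesis using that M(1) by (auto simp: A_def)
qed

text \<open>A nonunit generates a proper ideal and so lies in the maximal ideal, which also contains \<open>I\<close>;
  if \<open>1 + i\<close> were a nonunit, then \<open>1\<close> would lie there too.\<close>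

lemma (in local_ring) one_plus_proper_ideal_unit:
  assumes I: "ideal I R" "I \<noteq> carrier R" and i: "i \<in> I"
  shows "\<one> \<oplus> i \<in> Units R"
proof (rule ccontr)
  assume nonunit: "\<one> \<oplus> i \<notin> Units R"
  interpret I: ideal I R by fact
  have ic: "i \<in> carrier R" using i by (rule I.a_Hcarr)
  have ec: "\<one> \<oplus> i \<in> carrier R" using ic by simp
  obtain M where M: "maximalideal M R" "I \<subseteq> M" using proper_ideal_in_maximalideal[OF I] .
  have "\<one> \<notin> PIdl (\<one> \<oplus> i)"
  proof
    assume "\<one> \<in> PIdl (\<one> \<oplus> i)"
    then obtain x where x: "x \<in> carrier R" "x \<otimes> (\<one> \<oplus> i) = \<one>"
      by (auto simp: cgenideal_def)
    then have "(\<one> \<oplus> i) \<otimes> x = \<one>" using ic by (simp add: m_comm)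
    then show False using x ic nonunit unfolding Units_def by blast
  qed
  then have "PIdl (\<one> \<oplus> i) \<noteq> carrier R" by auto
  then obtain M' where M': "maximalideal M' R" "PIdl (\<one> \<oplus> i) \<subseteq> M'"
    by (rule proper_ideal_in_maximalideal[OF cgenideal_ideal[OF ec]])
  have "M' = M" using unique_maximalideal M(1) M'(1) by blast
  interpret M: maximalideal M R by fact
  have "\<one> \<oplus> i \<in> M" "i \<in> M"
    using M' M(2) i cgenideal_self[of "\<one> \<oplus> i"] ic \<open>M' = M\<close> by auto
  then have "(\<one> \<oplus> i) \<oplus> \<ominus> i \<in> M" by simp
  then have "\<one> \<in> M" using ic by (simp add: a_assoc r_neg)
  then show False using M.one_imp_carrier M.I_notcarr by simp
qed

section \<open>Nakayama's lemma\<close>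

context module
begin

lemma submodule_zero:
  assumes "submodule W R M"
  shows "\<zero>\<^bsub>M\<^esub> \<in> W"
  using submoduleE(1-5)[OF assms] by (metis M.r_neg all_not_in_conv subsetD)

text \<open>The case \<open>J = R\<close> gives the submodule \<open>W + Rb\<close>, and the case of a smaller ideal gives \<open>W + Jb\<close>;
  the proof of Nakayama's lemma compares the two.\<close>

lemma submodule_add_ideal_multiples:
  assumes W: "submodule W R M" and J: "ideal J R" and b: "b \<in> carrier M"
  shows "submodule {w \<oplus>\<^bsub>M\<^esub> i \<odot>\<^bsub>M\<^esub> b |w i. w \<in> W \<and> i \<in> J} R M"
proof -
  interpret J: ideal J R by fact
  note W' = submoduleE[OF W]
  have Wc: "w \<in> carrier M" if "w \<in> W" for w using that W'(1) by auto
  have W0: "\<zero>\<^bsub>M\<^esub> \<in> W" by (rule submodule_zero[OF W])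
  note Jc = J.a_Hcarr
  show ?thesis
  proof (rule submoduleI)
    show "{w \<oplus>\<^bsub>M\<^esub> i \<odot>\<^bsub>M\<^esub> b |w i. w \<in> W \<and> i \<in> J} \<subseteq> carrier M"
      using Wc Jc b by auto
    show "\<zero>\<^bsub>M\<^esub> \<in> {w \<oplus>\<^bsub>M\<^esub> i \<odot>\<^bsub>M\<^esub> b |w i. w \<in> W \<and> i \<in> J}"
      using W0 J.zero_closed b by (intro CollectI exI[of _ "\<zero>\<^bsub>M\<^esub>"] exI[of _ \<zero>]) auto
  next
    fix x assume "x \<in> {w \<oplus>\<^bsub>M\<^esub> i \<odot>\<^bsub>M\<^esub> b |w i. w \<in> W \<and> i \<in> J}"
    then obtain w i where x: "x = w \<oplus>\<^bsub>M\<^esub> i \<odot>\<^bsub>M\<^esub> b" "w \<in> W" "i \<in> J" by blast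
    have "\<ominus>\<^bsub>M\<^esub> x = \<ominus>\<^bsub>M\<^esub> w \<oplus>\<^bsub>M\<^esub> (\<ominus> i) \<odot>\<^bsub>M\<^esub> b"
      using x b Wc Jc by (simp add: smult_l_minus M.minus_add)
    then show "\<ominus>\<^bsub>M\<^esub> x \<in> {w \<oplus>\<^bsub>M\<^esub> i \<odot>\<^bsub>M\<^esub> b |w i. w \<in> W \<and> i \<in> J}"
      using x W'(3) J.a_inv_closed by blast
    fix a assume a: "a \<in> carrier R"
    have "a \<odot>\<^bsub>M\<^esub> x = a \<odot>\<^bsub>M\<^esub> w \<oplus>\<^bsub>M\<^esub> (a \<otimes> i) \<odot>\<^bsub>M\<^esub> b"
      using x b Wc Jc a by (simp add: smult_r_distr smult_assoc1)
    then show "a \<odot>\<^bsub>M\<^esub> x \<in> {w \<oplus>\<^bsub>M\<^esub> i \<odot>\<^bsub>M\<^esub> b |w i. w \<in> W \<and> i \<in> J}"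
      using x a W'(4) J.I_l_closed by blast
  next
    fix x y assume "x \<in> {w \<oplus>\<^bsub>M\<^esub> i \<odot>\<^bsub>M\<^esub> b |w i. w \<in> W \<and> i \<in> J}"
      and "y \<in> {w \<oplus>\<^bsub>M\<^esub> i \<odot>\<^bsub>M\<^esub> b |w i. w \<in> W \<and> i \<in> J}"
    then obtain w i w' i' where x: "x = w \<oplus>\<^bsub>M\<^esub> i \<odot>\<^bsub>M\<^esub> b" "w \<in> W" "i \<in> J"
      and y: "y = w' \<oplus>\<^bsub>M\<^esub> i' \<odot>\<^bsub>M\<^esub> b" "w' \<in> W" "i' \<in> J" by blast
    have "x \<oplus>\<^bsub>M\<^esub> y = (w \<oplus>\<^bsub>M\<^esub> w') \<oplus>\<^bsub>M\<^esub> (i \<oplus> i') \<odot>\<^bsub>M\<^esub> b"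
      using x y b Wc Jc by (simp add: smult_l_distr M.a_ac)
    then show "x \<oplus>\<^bsub>M\<^esub> y \<in> {w \<oplus>\<^bsub>M\<^esub> i \<odot>\<^bsub>M\<^esub> b |w i. w \<in> W \<and> i \<in> J}"
      using x y W'(5) J.a_closed by blast
  qed
qed

text \<open>Nakayama's lemma: if \<open>M\<close> is generated by \<open>W\<close> and a finite set \<open>K\<close>, and \<open>M = W + IM\<close>, then
  \<open>M = W\<close>. Induction on \<open>K\<close>, with \<open>W\<close> generalized, removes one generator \<open>b\<close> at a time. The induction
  hypothesis for \<open>W + Rb\<close> gives \<open>M = W + Rb\<close>, so \<open>M = W + IM \<subseteq> W + Ib\<close>. Hence \<open>b = w + ib\<close> with \<open>w \<in> W\<close>
  and \<open>i \<in> I\<close>, and \<open>b \<in> W\<close> because \<open>1 - i\<close> is a unit. That \<open>W \<union> K\<close> generates \<open>M\<close> is stated by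
  quantifying over the submodules that contain it.\<close>

lemma nakayama:
  assumes I: "ideal I R" and unit: "\<And>i. i \<in> I \<Longrightarrow> \<one> \<oplus> i \<in> Units R"
    and K: "finite K" "K \<subseteq> carrier M"
    and W: "submodule W R M"
    and sum: "\<And>x. x \<in> carrier M \<Longrightarrow> \<exists>w\<in>W. \<exists>n\<in>ideal_smult I M. x = w \<oplus>\<^bsub>M\<^esub> n"
    and span: "\<And>U. submodule U R M \<Longrightarrow> W \<subseteq> U \<Longrightarrow> K \<subseteq> U \<Longrightarrow> U = carrier M"
  shows "W = carrier M"
  using K W sum span
proof (induction K arbitrary: W)
  case empty
  then show ?case by simp
next
  case (insert b K)
  interpret I: ideal I R by (rule I)
  note W' = submoduleE[OF insert.prems(2)]
  have Wc: "w \<in> carrier M" if "w \<in> W" for w using that W'(1) by auto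
  have W0: "\<zero>\<^bsub>M\<^esub> \<in> W" by (rule submodule_zero[OF insert.prems(2)])
  have b: "b \<in> carrier M" using insert.prems by simp
  let ?U = "{w \<oplus>\<^bsub>M\<^esub> i \<odot>\<^bsub>M\<^esub> b |w i. w \<in> W \<and> i \<in> carrier R}"
  have sub: "submodule ?U R M" by (rule submodule_add_ideal_multiples[OF insert.prems(2) oneideal b])
  have WU: "W \<subseteq> ?U"
  proof
    fix w assume w: "w \<in> W"
    then have "w = w \<oplus>\<^bsub>M\<^esub> \<zero> \<odot>\<^bsub>M\<^esub> b" using b Wc by simp
    then show "w \<in> ?U" using w by blast
  qed
  have "b = \<zero>\<^bsub>M\<^esub> \<oplus>\<^bsub>M\<^esub> \<one> \<odot>\<^bsub>M\<^esub> b" using b by simp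
  then have bU: "b \<in> ?U" using W0 by blast
  have U: "?U = carrier M"
  proof (rule insert.IH)
    show "K \<subseteq> carrier M" using insert.prems by simp
    show "submodule ?U R M" by (rule sub)
    show "\<exists>w\<in>?U. \<exists>n\<in>ideal_smult I M. x = w \<oplus>\<^bsub>M\<^esub> n" if "x \<in> carrier M" for x
      using insert.prems(3)[OF that] WU by blast
    show "U = carrier M" if "submodule U R M" "?U \<subseteq> U" "K \<subseteq> U" for U
    proof (rule insert.prems(4)[OF that(1)])
      show "W \<subseteq> U" using WU that(2) by (rule subset_trans)
      show "insert b K \<subseteq> U" using bU that(2,3) by blast
    qed
  qed
  let ?T = "{w \<oplus>\<^bsub>M\<^esub> i \<odot>\<^bsub>M\<^esub> b |w i. w \<in> W \<and> i \<in> I}"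
  have T: "submodule ?T R M" by (rule submodule_add_ideal_multiples[OF insert.prems(2) I b])
  have "ideal_smult I M \<subseteq> ?T"
    unfolding ideal_smult_def
  proof (rule add.generate_subgroup_incl)
    show "subgroup ?T (add_monoid M)" using T by (rule submodule.axioms)
    show "{a \<odot>\<^bsub>M\<^esub> x |a x. a \<in> I \<and> x \<in> carrier M} \<subseteq> ?T"
    proof clarify
      fix a x assume a: "a \<in> I" and x: "x \<in> carrier M"
      from x obtain w s where ws: "x = w \<oplus>\<^bsub>M\<^esub> s \<odot>\<^bsub>M\<^esub> b" "w \<in> W" "s \<in> carrier R"
        unfolding U[symmetric] by blast
      have "a \<odot>\<^bsub>M\<^esub> x = a \<odot>\<^bsub>M\<^esub> w \<oplus>\<^bsub>M\<^esub> (a \<otimes> s) \<odot>\<^bsub>M\<^esub> b"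
        using ws a b Wc I.a_Hcarr by (simp add: smult_r_distr smult_assoc1)
      then show "\<exists>w i. a \<odot>\<^bsub>M\<^esub> x = w \<oplus>\<^bsub>M\<^esub> i \<odot>\<^bsub>M\<^esub> b \<and> w \<in> W \<and> i \<in> I"
        using W'(4)[OF I.a_Hcarr[OF a] ws(2)] I.I_r_closed[OF a ws(3)] by blast
    qed
  qed
  then obtain w w' i where *: "b = w \<oplus>\<^bsub>M\<^esub> (w' \<oplus>\<^bsub>M\<^esub> i \<odot>\<^bsub>M\<^esub> b)" "w \<in> W" "w' \<in> W" "i \<in> I"
  proof -
    obtain w n where wn: "w \<in> W" "n \<in> ideal_smult I M" "b = w \<oplus>\<^bsub>M\<^esub> n"
      using insert.prems(3)[OF b] by blast
    then have "n \<in> ?T" using \<open>ideal_smult I M \<subseteq> ?T\<close> by (rule_tac subsetD)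
    then obtain w' i where n: "n = w' \<oplus>\<^bsub>M\<^esub> i \<odot>\<^bsub>M\<^esub> b" "w' \<in> W" "i \<in> I" by (elim CollectE exE conjE)
    show ?thesis by (rule that[OF _ wn(1) n(2,3)]) (use wn(3) n(1) in simp)
  qed
  have ic: "i \<in> carrier R" using *(4) by (rule I.a_Hcarr)
  define e where "e = \<one> \<oplus> \<ominus> i"
  have e: "e \<in> Units R" unfolding e_def by (rule unit) (use *(4) in simp)
  have ec: "e \<in> carrier R" using ic by (simp add: e_def)
  have "e \<odot>\<^bsub>M\<^esub> b = b \<oplus>\<^bsub>M\<^esub> \<ominus>\<^bsub>M\<^esub> (i \<odot>\<^bsub>M\<^esub> b)"
    using ic b by (simp add: e_def smult_l_distr smult_l_minus)
  also have "\<dots> = ((w \<oplus>\<^bsub>M\<^esub> w') \<oplus>\<^bsub>M\<^esub> i \<odot>\<^bsub>M\<^esub> b) \<oplus>\<^bsub>M\<^esub> \<ominus>\<^bsub>M\<^esub> (i \<odot>\<^bsub>M\<^esub> b)"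
    by (subst (1) *(1)) (use *(2,3) ic b Wc in \<open>simp add: M.a_assoc\<close>)
  also have "\<dots> = w \<oplus>\<^bsub>M\<^esub> w'"
    using *(2,3) ic b Wc by (simp add: M.a_assoc M.r_neg)
  finally have eb: "e \<odot>\<^bsub>M\<^esub> b \<in> W" using *(2,3) W'(5) by simp
  have "b = inv e \<odot>\<^bsub>M\<^esub> (e \<odot>\<^bsub>M\<^esub> b)"
    using e ec b by (simp add: smult_assoc1[symmetric])
  then have "b \<in> W" using W'(4)[OF _ eb] e by (metis Units_inv_closed)
  then have "?U \<subseteq> W" by (auto intro!: W'(4,5))
  with WU have "W = ?U" by (rule equalityI)
  then show ?case unfolding U .
qed

lemma module_basis_span:
  assumes b: "module_basis R M J b" and U: "submodule U R M" "b ` J \<subseteq> U"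
  shows "U = carrier M"
proof
  note U' = submoduleE[OF U(1)]
  have Uc: "u \<in> carrier M" if "u \<in> U" for u using that U'(1) by auto
  have U0: "\<zero>\<^bsub>M\<^esub> \<in> U" by (rule submodule_zero[OF U(1)])
  show "U \<subseteq> carrier M" by (rule U')
  show "carrier M \<subseteq> U"
  proof
    fix x assume "x \<in> carrier M"
    then obtain c where c: "c \<in> J \<rightarrow> carrier R" "x = (\<Oplus>\<^bsub>M\<^esub>j\<in>J. c j \<odot>\<^bsub>M\<^esub> b j)"
      using b unfolding module_basis_def by blast
    have "finite J" using b by (simp add: module_basis_def)
    have "F \<subseteq> J \<Longrightarrow> (\<Oplus>\<^bsub>M\<^esub>j\<in>F. c j \<odot>\<^bsub>M\<^esub> b j) \<in> U" if "finite F" for F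
      using that
    proof (induction F)
      case empty
      then show ?case using U0 by simp
    next
      case (insert j F)
      have "c i \<odot>\<^bsub>M\<^esub> b i \<in> U" if "i \<in> J" for i
        using c(1) U(2) that by (intro U'(4)) auto
      then show ?case using insert Uc
        by (subst M.finsum_insert) (auto intro!: U'(5))
    qed
    then show "x \<in> U" using c(2) \<open>finite J\<close> by blast
  qed
qed

end


section \<open>Alternating forms and symplectic systems\<close>

locale alternating_module = module R M for R (structure) and M (structure) +
  fixes h :: "'c \<Rightarrow> 'c \<Rightarrow> 'a"
  assumes alternating: "alternating_form R M h"
begin

lemma bilinear: "bilinear_form R M h"
  using alternating by (simp add: alternating_form_def)

lemma form_closed [simp]: "x \<in> carrier M \<Longrightarrow> y \<in> carrier M \<Longrightarrow> h x y \<in> carrier R"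
  using bilinear by (simp add: bilinear_form_def)

lemma form_add_left:
  "x \<in> carrier M \<Longrightarrow> y \<in> carrier M \<Longrightarrow> z \<in> carrier M \<Longrightarrow> h (x \<oplus>\<^bsub>M\<^esub> y) z = h x z \<oplus> h y z"
  using bilinear by (simp add: bilinear_form_def)

lemma form_add_right:
  "x \<in> carrier M \<Longrightarrow> y \<in> carrier M \<Longrightarrow> z \<in> carrier M \<Longrightarrow> h z (x \<oplus>\<^bsub>M\<^esub> y) = h z x \<oplus> h z y"
  using bilinear by (simp add: bilinear_form_def)

lemma form_smult_left:
  "a \<in> carrier R \<Longrightarrow> x \<in> carrier M \<Longrightarrow> y \<in> carrier M \<Longrightarrow> h (a \<odot>\<^bsub>M\<^esub> x) y = a \<otimes> h x y"
  using bilinear by (simp add: bilinear_form_def)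

lemma form_smult_right:
  "a \<in> carrier R \<Longrightarrow> x \<in> carrier M \<Longrightarrow> y \<in> carrier M \<Longrightarrow> h x (a \<odot>\<^bsub>M\<^esub> y) = a \<otimes> h x y"
  using bilinear by (simp add: bilinear_form_def)

lemma form_self [simp]: "x \<in> carrier M \<Longrightarrow> h x x = \<zero>"
  using alternating by (simp add: alternating_form_def)

lemma form_zero_left [simp]: "x \<in> carrier M \<Longrightarrow> h \<zero>\<^bsub>M\<^esub> x = \<zero>"
  using form_smult_left[of \<zero> "\<zero>\<^bsub>M\<^esub>" x] by simp

lemma form_zero_right [simp]: "x \<in> carrier M \<Longrightarrow> h x \<zero>\<^bsub>M\<^esub> = \<zero>"
  using form_smult_right[of \<zero> x "\<zero>\<^bsub>M\<^esub>"] by simp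

lemma form_minus_left: "x \<in> carrier M \<Longrightarrow> y \<in> carrier M \<Longrightarrow> h (\<ominus>\<^bsub>M\<^esub> x) y = \<ominus> h x y"
  using form_smult_left[of "\<ominus> \<one>" x y] by (simp add: smult_l_minus l_minus)

lemma form_minus_right: "x \<in> carrier M \<Longrightarrow> y \<in> carrier M \<Longrightarrow> h x (\<ominus>\<^bsub>M\<^esub> y) = \<ominus> h x y"
  using form_smult_right[of "\<ominus> \<one>" x y] by (simp add: smult_l_minus l_minus)

lemma form_swap:
  assumes x: "x \<in> carrier M" and y: "y \<in> carrier M"
  shows "h y x = \<ominus> h x y"
proof -
  have "h (x \<oplus>\<^bsub>M\<^esub> y) (x \<oplus>\<^bsub>M\<^esub> y) = h x y \<oplus> h y x"
    using x y by (simp add: form_add_left form_add_right del: form_self) (simp add: x y R.a_comm)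
  then have "h x y \<oplus> h y x = \<zero>" using x y by simp
  then show ?thesis using x y R.minus_equality[of "h y x" "h x y"] by (simp add: R.a_comm)
qed

lemmas form_simps = form_add_left form_add_right form_smult_left form_smult_right
  form_minus_left form_minus_right

definition symplectic_system :: "nat \<Rightarrow> (nat \<Rightarrow> 'c) \<Rightarrow> (nat \<Rightarrow> 'c) \<Rightarrow> bool"
  where "symplectic_system k u v \<longleftrightarrow>
    u \<in> {1..k} \<rightarrow> carrier M \<and> v \<in> {1..k} \<rightarrow> carrier M \<and>
    (\<forall>i\<in>{1..k}. \<forall>j\<in>{1..k}. h (u i) (u j) = \<zero> \<and> h (v i) (v j) = \<zero> \<and>
      h (u i) (v j) = (if i = j then \<one> else \<zero>))"

text \<open>For a symplectic basis \<open>u, v\<close> the coordinates of \<open>x\<close> are \<open>h(x, v\<^sub>j)\<close> and \<open>-h(x, u\<^sub>j)\<close>, so the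
  following map is the linear map with \<open>u\<^sub>j \<mapsto> u\<^sub>j'\<close> and \<open>v\<^sub>j \<mapsto> v\<^sub>j'\<close>, written without a choice of
  coordinates. For \<open>u' = u\<close> and \<open>v' = v\<close> it is the orthogonal projection to the span of a
  symplectic system.\<close>

definition transfer ::
    "(nat \<Rightarrow> 'c) \<Rightarrow> (nat \<Rightarrow> 'c) \<Rightarrow> (nat \<Rightarrow> 'c) \<Rightarrow> (nat \<Rightarrow> 'c) \<Rightarrow> nat \<Rightarrow> 'c \<Rightarrow> 'c"
  where "transfer u v u' v' k x =
    (\<Oplus>\<^bsub>M\<^esub>j\<in>{1..k}. h x (v j) \<odot>\<^bsub>M\<^esub> u' j \<oplus>\<^bsub>M\<^esub> (\<ominus> h x (u j)) \<odot>\<^bsub>M\<^esub> v' j)"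

text \<open>The bound \<open>n\<close> is fixed while the sums grow up to it: the inductions below are on the number \<open>k \<le> n\<close>
  of summands, with the relations between all \<open>n\<close> pairs at hand.\<close>

context
  fixes u v u' v' :: "nat \<Rightarrow> 'c" and n :: nat
  assumes closed: "u \<in> {1..n} \<rightarrow> carrier M" "v \<in> {1..n} \<rightarrow> carrier M"
    "u' \<in> {1..n} \<rightarrow> carrier M" "v' \<in> {1..n} \<rightarrow> carrier M"
begin

lemma closed_components:
  assumes "1 \<le> j" "j \<le> n"
  shows "u j \<in> carrier M" "v j \<in> carrier M" "u' j \<in> carrier M" "v' j \<in> carrier M"
  using closed assms by auto

lemma transfer_closed:
  assumes "k \<le> n" "x \<in> carrier M"
  shows "transfer u v u' v' k x \<in> carrier M"
  unfolding transfer_def by (rule M.finsum_closed) (use assms in \<open>auto simp: closed_components\<close>)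

lemma transfer_0: "transfer u v u' v' 0 x = \<zero>\<^bsub>M\<^esub>"
  by (simp add: transfer_def)

lemma transfer_Suc:
  assumes "Suc k \<le> n" "x \<in> carrier M"
  shows "transfer u v u' v' (Suc k) x =
    h x (v (Suc k)) \<odot>\<^bsub>M\<^esub> u' (Suc k) \<oplus>\<^bsub>M\<^esub> (\<ominus> h x (u (Suc k))) \<odot>\<^bsub>M\<^esub> v' (Suc k) \<oplus>\<^bsub>M\<^esub> transfer u v u' v' k x"
proof -
  have "{1..Suc k} = insert (Suc k) {1..k}" by auto
  then show ?thesis
    unfolding transfer_def by (simp only:) (subst M.finsum_insert, use assms in \<open>auto simp: closed_components\<close>)
qed

lemma transfer_add:
  assumes "k \<le> n" "x \<in> carrier M" "y \<in> carrier M"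
  shows "transfer u v u' v' k (x \<oplus>\<^bsub>M\<^esub> y) = transfer u v u' v' k x \<oplus>\<^bsub>M\<^esub> transfer u v u' v' k y"
  using assms(1)
proof (induction k)
  case (Suc k)
  then show ?case using assms
    by (simp add: closed_components transfer_closed transfer_Suc form_simps smult_l_distr smult_l_minus R.minus_add M.a_ac M.minus_add)
qed (simp add: transfer_0)

lemma transfer_smult:
  assumes "k \<le> n" "a \<in> carrier R" "x \<in> carrier M"
  shows "transfer u v u' v' k (a \<odot>\<^bsub>M\<^esub> x) = a \<odot>\<^bsub>M\<^esub> transfer u v u' v' k x"
  using assms(1)
proof (induction k)
  case (Suc k)
  then show ?case using assms
    by (simp add: closed_components transfer_closed transfer_Suc form_simps smult_r_distr smult_assoc1 smult_l_minus smult_r_minus)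
qed (use assms in \<open>simp add: transfer_0\<close>)

lemma transfer_mod_hom: "transfer u v u' v' n \<in> mod_hom R M M"
  by (auto simp: closed_components transfer_closed mod_hom_def transfer_add transfer_smult)

lemma transfer_orthogonal:
  assumes "k \<le> n" "x \<in> carrier M" "z \<in> carrier M"
    and "\<And>j. 1 \<le> j \<Longrightarrow> j \<le> k \<Longrightarrow> h (u' j) z = \<zero> \<and> h (v' j) z = \<zero>"
  shows "h (transfer u v u' v' k x) z = \<zero>"
  using assms(1,4)
proof (induction k)
  case (Suc k)
  then show ?case using assms(2,3)
    by (simp add: closed_components transfer_closed transfer_Suc form_simps)
qed (simp add: transfer_0 assms closed_components)

text \<open>With \<open>u' = u\<close> and \<open>v' = v\<close> this is the defining property of the orthogonal projection; in
  general it says that \<open>transfer\<close> is adjoint to the map that sends \<open>u\<^sub>i', v\<^sub>i'\<close> back to \<open>u\<^sub>i, v\<^sub>i\<close>. Only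
  the summand with index \<open>i\<close> contributes.\<close>

lemma transfer_pairing:
  assumes sys: "symplectic_system n u' v'" and k: "k \<le> n" and x: "x \<in> carrier M"
    and i: "1 \<le> i" "i \<le> k"
  shows "h (transfer u v u' v' k x) (u' i) = h x (u i)"
    and "h (transfer u v u' v' k x) (v' i) = h x (v i)"
proof -
  have rel: "h (u' i) (u' j) = \<zero>" "h (v' i) (v' j) = \<zero>" "h (u' i) (v' j) = (if i = j then \<one> else \<zero>)"
    "h (v' i) (u' j) = (if i = j then \<ominus> \<one> else \<zero>)"
    if "1 \<le> i" "i \<le> n" "1 \<le> j" "j \<le> n" for i j
    using sys that closed_components form_swap[of "u' j" "v' i"] by (auto simp: symplectic_system_def)
  have "h (transfer u v u' v' k x) (u' i) = h x (u i) \<and> h (transfer u v u' v' k x) (v' i) = h x (v i)"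
    using k i
  proof (induction k)
    case (Suc k)
    show ?case
    proof (cases "i = Suc k")
      case True
      have "h (transfer u v u' v' k x) (u' i) = \<zero>" "h (transfer u v u' v' k x) (v' i) = \<zero>"
        using Suc.prems x True by (auto intro!: transfer_orthogonal simp: closed_components transfer_closed rel)
      then show ?thesis using Suc.prems x True
        by (simp add: closed_components transfer_closed transfer_Suc form_simps rel l_minus r_minus)
    next
      case False
      then have "i \<le> k" using Suc.prems by simp
      then show ?thesis using Suc x False
        by (simp add: closed_components transfer_closed transfer_Suc form_simps rel l_minus r_minus)
    qed
  qed simp
  then show "h (transfer u v u' v' k x) (u' i) = h x (u i)"
    and "h (transfer u v u' v' k x) (v' i) = h x (v i)" by auto
qed

lemma transfer_basis:
  assumes sys: "symplectic_system n u v" and i: "1 \<le> i" "i \<le> n"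
  shows "transfer u v u' v' n (u i) = u' i" and "transfer u v u' v' n (v i) = v' i"
proof -
  have rel: "h (u i) (u j) = \<zero>" "h (v i) (v j) = \<zero>" "h (u i) (v j) = (if i = j then \<one> else \<zero>)"
    "h (v i) (u j) = (if i = j then \<ominus> \<one> else \<zero>)"
    if "1 \<le> i" "i \<le> n" "1 \<le> j" "j \<le> n" for i j
    using sys that closed_components form_swap[of "u j" "v i"] by (auto simp: symplectic_system_def)
  have "transfer u v u' v' k (u i) = (if i \<le> k then u' i else \<zero>\<^bsub>M\<^esub>) \<and>
      transfer u v u' v' k (v i) = (if i \<le> k then v' i else \<zero>\<^bsub>M\<^esub>)" if "k \<le> n" for k
    using that
  proof (induction k)
    case 0
    then show ?case using i by (simp add: transfer_0 closed_components transfer_closed)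
  next
    case (Suc k)
    then show ?case using i by (cases "i = Suc k") (auto simp: closed_components transfer_closed transfer_Suc rel)
  qed
  from this[of n] show "transfer u v u' v' n (u i) = u' i" and "transfer u v u' v' n (v i) = v' i"
    using i by auto
qed

text \<open>The equation is linear in \<open>y\<close>, so it is enough to have it for \<open>y = u\<^sub>i\<close> and \<open>y = v\<^sub>i\<close>. There it is
  the adjointness of \<open>transfer_pairing\<close>.\<close>

lemma transfer_isometry:
  assumes sys: "symplectic_system n u v" "symplectic_system n u' v'"
    and span: "\<And>U. submodule U R M \<Longrightarrow> u ` {1..n} \<union> v ` {1..n} \<subseteq> U \<Longrightarrow> U = carrier M"
    and x: "x \<in> carrier M" and y: "y \<in> carrier M"
  shows "h (transfer u v u' v' n x) (transfer u v u' v' n y) = h x y"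
proof -
  let ?U = "{y \<in> carrier M. h (transfer u v u' v' n x) (transfer u v u' v' n y) = h x y}"
  have "?U = carrier M"
  proof (rule span)
    show "u ` {1..n} \<union> v ` {1..n} \<subseteq> ?U"
      using x by (auto simp: closed_components transfer_closed transfer_basis[OF sys(1)] transfer_pairing[OF sys(2)])
    have T0: "transfer u v u' v' n \<zero>\<^bsub>M\<^esub> = \<zero>\<^bsub>M\<^esub>"
      using transfer_smult[of n \<zero> "\<zero>\<^bsub>M\<^esub>"] by (simp add: transfer_closed)
    have Tm: "transfer u v u' v' n (\<ominus>\<^bsub>M\<^esub> y) = \<ominus>\<^bsub>M\<^esub> transfer u v u' v' n y" if "y \<in> carrier M" for y
      using transfer_smult[of n "\<ominus> \<one>" y] that by (simp add: smult_l_minus closed_components transfer_closed)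
    show "submodule ?U R M"
      by (rule submoduleI) (use x in \<open>auto simp: closed_components transfer_closed T0 Tm transfer_add transfer_smult form_simps\<close>)
  qed
  then show ?thesis using y by blast
qed

end

end


section \<open>Lifting symplectic systems\<close>

text \<open>The assumption says that \<open>I\<close> is contained in the Jacobson radical of \<open>R\<close>. This is how locality
  of the ring enters.\<close>

locale radical_reduction = alternating_module R M h + I: ideal I R
  for R (structure) and M (structure) and h and I +
  assumes one_plus_unit: "i \<in> I \<Longrightarrow> \<one> \<oplus> i \<in> Units R"
begin

abbreviation N where "N \<equiv> ideal_smult I M"

interpretation N: abelian_subgroup N M
  by (rule ideal_smult_abelian_subgroup) (rule I.is_ideal)

lemma coset_zero_iff: "a \<in> carrier R \<Longrightarrow> I +> a = I +> \<zero> \<longleftrightarrow> a \<in> I"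
  by (metis I.a_rcos_const I.a_rcos_self I.zero_closed)

lemma coset_add_ideal_smult:
  "x \<in> carrier M \<Longrightarrow> n \<in> N \<Longrightarrow> N +>\<^bsub>M\<^esub> (x \<oplus>\<^bsub>M\<^esub> n) = N +>\<^bsub>M\<^esub> x"
  using red_coset_eqI[OF I.is_ideal, of x n] by (simp add: M.a_comm N.a_Hcarr)

text \<open>Cosets rather than differences express congruence modulo \<open>IM\<close>; the form respects them because
  the reduced form is well defined.\<close>

lemma form_coset_cong:
  assumes "x \<in> carrier M" "x' \<in> carrier M" "y \<in> carrier M" "y' \<in> carrier M"
    and "N +>\<^bsub>M\<^esub> x = N +>\<^bsub>M\<^esub> x'" "N +>\<^bsub>M\<^esub> y = N +>\<^bsub>M\<^esub> y'"
  shows "I +> h x y = I +> h x' y'"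
  using red_form_coset[OF I.is_ideal bilinear assms(1,3)] red_form_coset[OF I.is_ideal bilinear assms(2,4)]
  unfolding assms(5,6) by simp

lemma transfer_in_ideal_smult:
  assumes closed: "u \<in> {1..n} \<rightarrow> carrier M" "v \<in> {1..n} \<rightarrow> carrier M"
      "u' \<in> {1..n} \<rightarrow> carrier M" "v' \<in> {1..n} \<rightarrow> carrier M"
    and x: "x \<in> carrier M"
    and orth: "\<And>j. j \<in> {1..n} \<Longrightarrow> h x (u j) \<in> I \<and> h x (v j) \<in> I"
  shows "transfer u v u' v' n x \<in> N"
proof -
  have "transfer u v u' v' k x \<in> N" if "k \<le> n" for k
    using that
  proof (induction k)
    case 0
    then show ?case by (simp add: transfer_0[OF closed] N.zero_closed)
  next
    case (Suc k)
    have "u' (Suc k) \<in> carrier M" "v' (Suc k) \<in> carrier M" using Pi_mem[OF closed(3)] Pi_mem[OF closed(4)] Suc.prems by simp_all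
    moreover have "h x (u (Suc k)) \<in> I" "h x (v (Suc k)) \<in> I" using orth[of "Suc k"] Suc.prems by auto
    moreover have "transfer u v u' v' k x \<in> N" using Suc by simp
    ultimately show ?case unfolding transfer_Suc[OF closed Suc.prems x]
      by (intro N.a_closed ideal_smultI[OF I.is_ideal] I.a_inv_closed)
  qed
  then show ?thesis by simp
qed

text \<open>The Gram-Schmidt process. The step from \<open>k\<close> to \<open>k + 1\<close> keeps the lifts of the first \<open>k\<close> pairs,
  makes the next pair orthogonal to them, and rescales its second member.\<close>

lemma lift_symplectic_system:
  assumes "x \<in> {1..k} \<rightarrow> carrier M" "y \<in> {1..k} \<rightarrow> carrier M"
    and "\<And>i j. i \<in> {1..k} \<Longrightarrow> j \<in> {1..k} \<Longrightarrow> h (x i) (x j) \<in> I \<and> h (y i) (y j) \<in> I"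
    and "\<And>i j. i \<in> {1..k} \<Longrightarrow> j \<in> {1..k} \<Longrightarrow> I +> h (x i) (y j) = I +> (if i = j then \<one> else \<zero>)"
  shows "\<exists>u v. symplectic_system k u v \<and>
    (\<forall>i\<in>{1..k}. N +>\<^bsub>M\<^esub> u i = N +>\<^bsub>M\<^esub> x i \<and> N +>\<^bsub>M\<^esub> v i = N +>\<^bsub>M\<^esub> y i)"
  using assms
proof (induction k)
  case 0
  then show ?case by (simp add: symplectic_system_def)
next
  case (Suc k)
  have "\<exists>u v. symplectic_system k u v \<and>
    (\<forall>i\<in>{1..k}. N +>\<^bsub>M\<^esub> u i = N +>\<^bsub>M\<^esub> x i \<and> N +>\<^bsub>M\<^esub> v i = N +>\<^bsub>M\<^esub> y i)"
  proof (rule Suc.IH)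
    show "x \<in> {1..k} \<rightarrow> carrier M" "y \<in> {1..k} \<rightarrow> carrier M"
      using Suc.prems(1,2) by (simp_all add: Pi_iff)
    fix i j assume "i \<in> {1..k}" "j \<in> {1..k}"
    then have ij: "i \<in> {1..Suc k}" "j \<in> {1..Suc k}" by simp_all
    show "h (x i) (x j) \<in> I \<and> h (y i) (y j) \<in> I" by (rule Suc.prems(3)[OF ij])
    show "I +> h (x i) (y j) = I +> (if i = j then \<one> else \<zero>)" by (rule Suc.prems(4)[OF ij])
  qed
  then obtain u v where sys: "symplectic_system k u v"
    and lift: "\<And>i. i \<in> {1..k} \<Longrightarrow> N +>\<^bsub>M\<^esub> u i = N +>\<^bsub>M\<^esub> x i \<and> N +>\<^bsub>M\<^esub> v i = N +>\<^bsub>M\<^esub> y i"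
    by blast
  have closed: "u \<in> {1..k} \<rightarrow> carrier M" "v \<in> {1..k} \<rightarrow> carrier M"
    using sys by (auto simp: symplectic_system_def)
  have xy: "x i \<in> carrier M" "y i \<in> carrier M" if "i \<in> {1..Suc k}" for i
    using Suc.prems(1,2) that by auto
  \<comment> \<open>\<open>P\<close> is the projection to the orthogonal complement of the pairs found so far.\<close>
  define P where "P z = z \<oplus>\<^bsub>M\<^esub> \<ominus>\<^bsub>M\<^esub> transfer u v u v k z" for z
  have Pc: "P z \<in> carrier M" if "z \<in> carrier M" for z
    using that transfer_closed[OF closed closed] by (simp add: P_def)
  have orth: "h (P z) (u j) = \<zero>" "h (P z) (v j) = \<zero>" if "z \<in> carrier M" "j \<in> {1..k}" for z j
  proof -
    have "u j \<in> carrier M" "v j \<in> carrier M" "transfer u v u v k z \<in> carrier M"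
      using that closed transfer_closed[OF closed closed] by auto
    then show "h (P z) (u j) = \<zero>" "h (P z) (v j) = \<zero>"
      using that transfer_pairing[OF closed closed sys]
      by (simp_all add: P_def form_simps R.r_neg)
  qed
  \<comment> \<open>On vectors that are orthogonal modulo \<open>I\<close> to the given pairs, \<open>P\<close> does not change the class.\<close>
  have P_coset: "N +>\<^bsub>M\<^esub> P z = N +>\<^bsub>M\<^esub> z"
    if z: "z \<in> carrier M" and zI: "\<And>j. j \<in> {1..k} \<Longrightarrow> h z (x j) \<in> I \<and> h z (y j) \<in> I" for z
  proof -
    have "transfer u v u v k z \<in> N"
    proof (rule transfer_in_ideal_smult[OF closed closed z])
      fix j assume j: "j \<in> {1..k}"
      then have c: "u j \<in> carrier M" "v j \<in> carrier M" "x j \<in> carrier M" "y j \<in> carrier M"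
        using closed xy by auto
      have "I +> h z (u j) = I +> h z (x j)" "I +> h z (v j) = I +> h z (y j)"
        by (rule form_coset_cong; use z c lift[OF j] in simp)+
      then show "h z (u j) \<in> I \<and> h z (v j) \<in> I"
        using zI[OF j] z c by (metis coset_zero_iff form_closed)
    qed
    then show ?thesis using z by (simp add: P_def coset_add_ideal_smult)
  qed
  have k: "Suc k \<in> {1..Suc k}" by simp
  have cross: "h (x i) (y j) \<in> I" if "i \<in> {1..Suc k}" "j \<in> {1..Suc k}" "i \<noteq> j" for i j
    using Suc.prems(4)[OF that(1,2)] that xy by (simp add: coset_zero_iff)
  define a b where "a = P (x (Suc k))" and "b = P (y (Suc k))"
  have ac: "a \<in> carrier M" and bc: "b \<in> carrier M"
    using xy[OF k] by (auto simp: a_def b_def Pc)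
  have a: "N +>\<^bsub>M\<^esub> a = N +>\<^bsub>M\<^esub> x (Suc k)"
    unfolding a_def by (rule P_coset) (use xy[OF k] Suc.prems(3)[OF k] cross[OF k] in auto)
  have "h (y (Suc k)) (x j) \<in> I" if "j \<in> {1..k}" for j
    using cross[of j "Suc k"] xy[OF k] xy[of j] that form_swap[of "x j" "y (Suc k)"] by auto
  then have b: "N +>\<^bsub>M\<^esub> b = N +>\<^bsub>M\<^esub> y (Suc k)"
    unfolding b_def by (intro P_coset) (use xy[OF k] Suc.prems(3)[OF k] in auto)
  define e where "e = h a b"
  have "I +> e = I +> \<one>"
    using form_coset_cong[OF ac xy(1)[OF k] bc xy(2)[OF k] a b] Suc.prems(4)[OF k k]
    by (simp add: e_def)
  moreover have ec: "e \<in> carrier R" using ac bc by (simp add: e_def)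
  ultimately have "e \<in> I +> \<one>" using I.a_rcos_self by metis
  then obtain i where i: "i \<in> I" "e = i \<oplus> \<one>" by (auto simp: a_r_coset_def')
  then have ic: "i \<in> carrier R" by (simp add: I.a_Hcarr)
  have eU: "e \<in> Units R" using one_plus_unit[OF i(1)] i(2) ic by (simp add: R.a_comm)
  define d where "d = inv e"
  have d: "d \<in> carrier R" "d \<otimes> e = \<one>" using eU by (auto simp: d_def)
  \<comment> \<open>Since \<open>d \<in> 1 + I\<close>, multiplying by \<open>d\<close> does not change the class of \<open>b\<close>.\<close>
  have "d = \<one> \<oplus> \<ominus> (d \<otimes> i)"
  proof -
    have "d \<oplus> d \<otimes> i = \<one>" using d ic unfolding i(2) by (simp add: r_distr R.a_comm)
    then have "\<one> \<oplus> \<ominus> (d \<otimes> i) = (d \<oplus> d \<otimes> i) \<oplus> \<ominus> (d \<otimes> i)" by simp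
    also have "\<dots> = d" using d ic by (simp add: R.a_assoc R.r_neg)
    finally show ?thesis ..
  qed
  then have "d \<odot>\<^bsub>M\<^esub> b = (\<one> \<oplus> \<ominus> (d \<otimes> i)) \<odot>\<^bsub>M\<^esub> b" by simp
  also have "\<dots> = b \<oplus>\<^bsub>M\<^esub> (\<ominus> (d \<otimes> i)) \<odot>\<^bsub>M\<^esub> b" using d ic bc by (simp add: smult_l_distr)
  finally have "N +>\<^bsub>M\<^esub> (d \<odot>\<^bsub>M\<^esub> b) = N +>\<^bsub>M\<^esub> b"
    using d i bc by (simp add: coset_add_ideal_smult ideal_smultI[OF I.is_ideal] I.I_l_closed)
  then have db: "N +>\<^bsub>M\<^esub> (d \<odot>\<^bsub>M\<^esub> b) = N +>\<^bsub>M\<^esub> y (Suc k)" using b by simp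
  have uv: "u j \<in> carrier M" "v j \<in> carrier M" if "j \<in> {1..k}" for j
    using closed that by auto
  have rel_a: "h a (u j) = \<zero>" "h a (v j) = \<zero>" "h (u j) a = \<zero>" "h (v j) a = \<zero>"
    if "j \<in> {1..k}" for j
    using orth[OF xy(1)[OF k] that] uv[OF that] ac form_swap[of a]
    by (auto simp: a_def[symmetric])
  have rel_b: "h b (u j) = \<zero>" "h b (v j) = \<zero>" "h (u j) b = \<zero>" "h (v j) b = \<zero>"
    if "j \<in> {1..k}" for j
    using orth[OF xy(2)[OF k] that] uv[OF that] bc form_swap[of b]
    by (auto simp: b_def[symmetric])
  have ab: "h a (d \<odot>\<^bsub>M\<^esub> b) = \<one>" using ac bc d by (simp add: form_simps e_def[symmetric])
  have rel_uv: "h (u i) (u j) = \<zero>" "h (v i) (v j) = \<zero>" "h (u i) (v j) = (if i = j then \<one> else \<zero>)"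
    if "i \<in> {1..k}" "j \<in> {1..k}" for i j
    using sys that by (auto simp: symplectic_system_def)
  have last: "i = Suc k \<or> i \<in> {1..k} \<and> i \<noteq> Suc k" if "i \<in> {1..Suc k}" for i using that by auto
  have "symplectic_system (Suc k) (u(Suc k := a)) (v(Suc k := d \<odot>\<^bsub>M\<^esub> b))"
    unfolding symplectic_system_def
  proof (intro conjI ballI)
    fix i j assume ij: "i \<in> {1..Suc k}" "j \<in> {1..Suc k}"
    show "h ((u(Suc k := a)) i) ((u(Suc k := a)) j) = \<zero>"
      "h ((v(Suc k := d \<odot>\<^bsub>M\<^esub> b)) i) ((v(Suc k := d \<odot>\<^bsub>M\<^esub> b)) j) = \<zero>"
      "h ((u(Suc k := a)) i) ((v(Suc k := d \<odot>\<^bsub>M\<^esub> b)) j) = (if i = j then \<one> else \<zero>)"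
      using last[OF ij(1)] last[OF ij(2)] ac bc d uv
      by (auto simp: rel_uv rel_a rel_b ab form_simps)
  qed (use closed ac bc d in \<open>auto simp: Pi_iff\<close>)
  moreover have "\<forall>i\<in>{1..Suc k}. N +>\<^bsub>M\<^esub> (u(Suc k := a)) i = N +>\<^bsub>M\<^esub> x i \<and>
      N +>\<^bsub>M\<^esub> (v(Suc k := d \<odot>\<^bsub>M\<^esub> b)) i = N +>\<^bsub>M\<^esub> y i"
    using a db lift by auto
  ultimately show ?case by blast
qed

text \<open>An isometry is injective for a nondegenerate form. If its reduction modulo \<open>I\<close> is onto, then
  \<open>M = X(M) + IM\<close>, and Nakayama's lemma makes it onto.\<close>

lemma isometry_bij_betw:
  assumes nondeg: "nondegenerate_form R M h"
    and K: "finite K" "K \<subseteq> carrier M"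
    and span: "\<And>U. submodule U R M \<Longrightarrow> K \<subseteq> U \<Longrightarrow> U = carrier M"
    and X: "X \<in> mod_hom R M M"
    and iso: "\<And>x y. x \<in> carrier M \<Longrightarrow> y \<in> carrier M \<Longrightarrow> h (X x) (X y) = h x y"
    and onto: "\<And>y. y \<in> carrier M \<Longrightarrow> \<exists>x\<in>carrier M. N +>\<^bsub>M\<^esub> X x = N +>\<^bsub>M\<^esub> y"
  shows "bij_betw X (carrier M) (carrier M)"
proof -
  have Xc: "X x \<in> carrier M" if "x \<in> carrier M" for x using X that by (auto simp: mod_hom_def)
  have Xadd: "X (x \<oplus>\<^bsub>M\<^esub> y) = X x \<oplus>\<^bsub>M\<^esub> X y" if "x \<in> carrier M" "y \<in> carrier M" for x y
    using X that by (simp add: mod_hom_def)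
  have Xsmult: "X (a \<odot>\<^bsub>M\<^esub> x) = a \<odot>\<^bsub>M\<^esub> X x" if "a \<in> carrier R" "x \<in> carrier M" for a x
    using X that by (simp add: mod_hom_def)
  have "inj_on X (carrier M)"
  proof (rule inj_onI)
    fix x y assume xy: "x \<in> carrier M" "y \<in> carrier M" "X x = X y"
    have "h x z = h y z" if "z \<in> carrier M" for z
      using iso[OF xy(1) that] iso[OF xy(2) that] xy(3) by simp
    then have "(\<lambda>z\<in>carrier M. h x z) = (\<lambda>z\<in>carrier M. h y z)"
      by (intro restrict_ext) simp
    then show "x = y"
      using nondeg xy(1,2) unfolding nondegenerate_form_def bij_betw_def by (auto dest: inj_onD)
  qed
  moreover have "X ` carrier M = carrier M"
  proof (rule nakayama[OF I.is_ideal one_plus_unit K])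
    show "submodule (X ` carrier M) R M"
    proof (rule submoduleI)
      show "\<zero>\<^bsub>M\<^esub> \<in> X ` carrier M"
        using Xsmult[of \<zero> "\<zero>\<^bsub>M\<^esub>"] Xc by (intro image_eqI[of _ _ "\<zero>\<^bsub>M\<^esub>"]) simp_all
      show "\<ominus>\<^bsub>M\<^esub> y \<in> X ` carrier M" if y: "y \<in> X ` carrier M" for y
      proof -
        obtain x where x: "x \<in> carrier M" "y = X x" using y by blast
        then have "\<ominus>\<^bsub>M\<^esub> y = X ((\<ominus> \<one>) \<odot>\<^bsub>M\<^esub> x)"
          using Xc[OF x(1)] Xsmult[OF _ x(1), of "\<ominus> \<one>"] smult_l_minus[OF _ Xc[OF x(1)], of \<one>] by simp
        then show ?thesis using x(1) by (intro image_eqI[of _ X "(\<ominus> \<one>) \<odot>\<^bsub>M\<^esub> x"]) simp_all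
      qed
      show "x \<oplus>\<^bsub>M\<^esub> y \<in> X ` carrier M" if xy: "x \<in> X ` carrier M" "y \<in> X ` carrier M" for x y
      proof -
        obtain x' y' where "x' \<in> carrier M" "x = X x'" "y' \<in> carrier M" "y = X y'" using xy by blast
        then show ?thesis by (intro image_eqI[of _ _ "x' \<oplus>\<^bsub>M\<^esub> y'"]) (simp_all add: Xadd)
      qed
      show "a \<odot>\<^bsub>M\<^esub> x \<in> X ` carrier M" if a: "a \<in> carrier R" and x: "x \<in> X ` carrier M" for a x
      proof -
        obtain x' where "x' \<in> carrier M" "x = X x'" using x by blast
        then show ?thesis
          using a by (intro image_eqI[of _ _ "a \<odot>\<^bsub>M\<^esub> x'"]) (simp_all add: Xsmult)
      qed
    qed (use Xc in blast)
    show "\<exists>w\<in>X ` carrier M. \<exists>n\<in>N. y = w \<oplus>\<^bsub>M\<^esub> n" if y: "y \<in> carrier M" for y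
    proof -
      obtain x where x: "x \<in> carrier M" "N +>\<^bsub>M\<^esub> X x = N +>\<^bsub>M\<^esub> y" using onto[OF y] by blast
      then have "y \<in> N +>\<^bsub>M\<^esub> X x" using N.a_rcos_self[OF y] by simp
      then obtain n where n: "n \<in> N" "y = n \<oplus>\<^bsub>M\<^esub> X x" by (auto simp: a_r_coset_def')
      then have "y = X x \<oplus>\<^bsub>M\<^esub> n" using Xc[OF x(1)] N.a_Hcarr[OF n(1)] by (simp add: M.a_comm)
      then show ?thesis using x(1) n(1) by blast
    qed
    show "U = carrier M" if "submodule U R M" "K \<subseteq> U" for U
      using span that .
  qed
  ultimately show ?thesis by (simp add: bij_betw_def)
qed

end

section \<open>The reduction homomorphism\<close>

lemma Sp_iff:
  "g \<in> carrier (Sp R M h) \<longleftrightarrow> g \<in> Bij (carrier M) \<and> g \<in> mod_hom R M M \<and>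
    (\<forall>x\<in>carrier M. \<forall>y\<in>carrier M. h (g x) (g y) = h x y)"
  by (auto simp: Sp_def)

lemma Sp_mult:
  assumes "f \<in> carrier (Sp R M h)" "g \<in> carrier (Sp R M h)"
  shows "f \<otimes>\<^bsub>Sp R M h\<^esub> g = compose (carrier M) f g"
  using assms by (simp add: Sp_iff) (simp add: Sp_def BijGroup_def)

lemma mod_hom_compose:
  assumes "f \<in> mod_hom R M M" "g \<in> mod_hom R M M" "module R M"
  shows "compose (carrier M) f g \<in> mod_hom R M M"
proof -
  interpret module R M by fact
  have "g x \<in> carrier M" if "x \<in> carrier M" for x using assms(2) that by (auto simp: mod_hom_def)
  then show ?thesis using assms(1,2) by (auto simp: mod_hom_def compose_def)
qed

lemma mod_hom_inverse:
  assumes g: "g \<in> mod_hom R M M" "bij_betw g (carrier M) (carrier M)" and "module R M"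
  shows "inv_into (carrier M) g \<in> mod_hom R M M"
proof -
  interpret module R M by fact
  let ?k = "inv_into (carrier M) g"
  have k: "?k y \<in> carrier M" "g (?k y) = y" if "y \<in> carrier M" for y
    using g(2) that by (auto simp: bij_betw_def inv_into_into f_inv_into_f)
  have kg: "?k (g x) = x" if "x \<in> carrier M" for x
    using g(2) that by (auto simp: bij_betw_def)
  have "?k (x \<oplus>\<^bsub>M\<^esub> y) = ?k x \<oplus>\<^bsub>M\<^esub> ?k y" if "x \<in> carrier M" "y \<in> carrier M" for x y
  proof -
    have "x \<oplus>\<^bsub>M\<^esub> y = g (?k x \<oplus>\<^bsub>M\<^esub> ?k y)" using g(1) k that by (simp add: mod_hom_def)
    then show ?thesis using kg k that by simp
  qed
  moreover have "?k (a \<odot>\<^bsub>M\<^esub> x) = a \<odot>\<^bsub>M\<^esub> ?k x" if "a \<in> carrier R" "x \<in> carrier M" for a x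
  proof -
    have "a \<odot>\<^bsub>M\<^esub> x = g (a \<odot>\<^bsub>M\<^esub> ?k x)" using g(1) k that by (simp add: mod_hom_def)
    then show ?thesis using kg k that by simp
  qed
  ultimately show ?thesis using k by (simp add: mod_hom_def)
qed

context module
begin

lemma Quot_carrier: "carrier (R Quot I) = (\<lambda>a. I +>\<^bsub>R\<^esub> a) ` carrier R"
  by (auto simp: FactRing_def A_RCOSETS_def')

lemma red_map_mod_hom:
  assumes I: "ideal I R" and g: "g \<in> mod_hom R M M"
  shows "red_map I M g \<in> mod_hom (R Quot I) (red_module I M) (red_module I M)"
proof -
  have "g x \<in> carrier M" if "x \<in> carrier M" for x using g that by (auto simp: mod_hom_def)
  moreover have "g (x \<oplus>\<^bsub>M\<^esub> y) = g x \<oplus>\<^bsub>M\<^esub> g y" if "x \<in> carrier M" "y \<in> carrier M" for x y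
    using g that by (simp add: mod_hom_def)
  moreover have "g (a \<odot>\<^bsub>M\<^esub> x) = a \<odot>\<^bsub>M\<^esub> g x" if "a \<in> carrier R" "x \<in> carrier M" for a x
    using g that by (simp add: mod_hom_def)
  ultimately show ?thesis
    unfolding mod_hom_def
    by (auto simp: red_carrier[OF I] Quot_carrier red_map_coset[OF I g] red_add_coset[OF I]
        red_smult_coset[OF I])
qed

text \<open>The inverse of \<open>g\<close> is linear as well, so its reduction is well defined, and it inverts the
  reduction of \<open>g\<close>.\<close>

lemma red_map_Bij:
  assumes I: "ideal I R" and g: "g \<in> mod_hom R M M" "bij_betw g (carrier M) (carrier M)"
  shows "red_map I M g \<in> Bij (carrier (red_module I M))"
proof -
  let ?k = "inv_into (carrier M) g"
  have k: "?k \<in> mod_hom R M M" by (rule mod_hom_inverse[OF g]) (rule module_axioms)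
  have gc: "g x \<in> carrier M" "?k x \<in> carrier M" "g (?k x) = x" "?k (g x) = x" if "x \<in> carrier M" for x
    using g that k by (auto simp: mod_hom_def bij_betw_def f_inv_into_f)
  have "bij_betw (red_map I M g) (carrier (red_module I M)) (carrier (red_module I M))"
    by (rule bij_betw_byWitness[of _ "red_map I M ?k"])
      (auto simp: red_carrier[OF I] red_map_coset[OF I g(1)] red_map_coset[OF I k] gc)
  then show ?thesis by (simp add: Bij_def red_map_def)
qed

lemma red_map_compose:
  assumes I: "ideal I R" and f: "f \<in> mod_hom R M M" and g: "g \<in> mod_hom R M M"
  shows "red_map I M (compose (carrier M) f g) =
    compose (carrier (red_module I M)) (red_map I M f) (red_map I M g)"
proof (rule extensionalityI[of _ "carrier (red_module I M)"])
  have gc: "g x \<in> carrier M" if "x \<in> carrier M" for x using g that by (auto simp: mod_hom_def)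
  note fg = mod_hom_compose[OF f g module_axioms]
  fix A assume A: "A \<in> carrier (red_module I M)"
  then obtain x where x: "x \<in> carrier M" "A = ideal_smult I M +>\<^bsub>M\<^esub> x" by (auto simp: red_carrier[OF I])
  show "red_map I M (compose (carrier M) f g) A =
    compose (carrier (red_module I M)) (red_map I M f) (red_map I M g) A"
    using A x(1) gc[OF x(1)]
    by (simp add: compose_eq) (simp add: x(2) red_map_coset[OF I] f g fg compose_eq)
qed (simp_all add: red_map_def)

end

lemma (in alternating_module) red_map_hom:
  assumes I: "ideal I R"
  shows "red_map I M \<in> hom (Sp R M h) (Sp (R Quot I) (red_module I M) (red_form R I h))"
proof -
  let ?Sp' = "Sp (R Quot I) (red_module I M) (red_form R I h)"
  have mem: "red_map I M g \<in> carrier ?Sp'" if "g \<in> carrier (Sp R M h)" for g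
  proof -
    have g: "g \<in> mod_hom R M M" "bij_betw g (carrier M) (carrier M)"
      "\<And>x y. x \<in> carrier M \<Longrightarrow> y \<in> carrier M \<Longrightarrow> h (g x) (g y) = h x y"
      using that by (auto simp: Sp_iff Bij_def)
    have gc: "g x \<in> carrier M" if "x \<in> carrier M" for x using g(1) that by (auto simp: mod_hom_def)
    show ?thesis
      using red_map_Bij[OF I g(1,2)] red_map_mod_hom[OF I g(1)]
      by (auto simp: Sp_iff red_carrier[OF I] red_map_coset[OF I g(1)] red_form_coset[OF I bilinear] gc g(3))
  qed
  show ?thesis
  proof (rule homI)
    fix f g assume fg: "f \<in> carrier (Sp R M h)" "g \<in> carrier (Sp R M h)"
    then have "red_map I M (compose (carrier M) f g) =
        compose (carrier (red_module I M)) (red_map I M f) (red_map I M g)"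
      by (intro red_map_compose[OF I]) (simp_all add: Sp_iff)
    then show "red_map I M (f \<otimes>\<^bsub>Sp R M h\<^esub> g) = red_map I M f \<otimes>\<^bsub>?Sp'\<^esub> red_map I M g"
      by (simp only: Sp_mult fg mem)
  qed (rule mem)
qed

text \<open>The preimage of \<open>g\<close> is the map \<open>X\<close> that transfers the symplectic basis to a lift of its image
  under \<open>g\<close>. The vectors on which the reduction of \<open>X\<close> agrees with \<open>g\<close> form a submodule that contains
  the basis.\<close>

lemma (in radical_reduction) red_map_surj:
  assumes nondeg: "nondegenerate_form R M h" and basis: "symplectic_basis R M h m u v"
    and g: "g \<in> carrier (Sp (R Quot I) (red_module I M) (red_form R I h))"
  shows "g \<in> red_map I M ` carrier (Sp R M h)"
proof -
  have sys: "symplectic_system m u v"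
  proof -
    have "case_sum u v \<in> Sum_Type.Plus {1..m} {1..m} \<rightarrow> carrier M"
      using basis by (simp add: symplectic_basis_def module_basis_def)
    then have "u i \<in> carrier M" "v i \<in> carrier M" if "i \<in> {1..m}" for i
      using that by (force dest: Pi_mem[of _ _ _ "Inl i"] Pi_mem[of _ _ _ "Inr i"])+
    then show ?thesis using basis by (auto simp: symplectic_system_def symplectic_basis_def)
  qed
  then have uv: "u i \<in> carrier M" "v i \<in> carrier M" if "i \<in> {1..m}" for i
    using that by (auto simp: symplectic_system_def)
  let ?K = "u ` {1..m} \<union> v ` {1..m}"
  have span: "U = carrier M" if U: "submodule U R M" "?K \<subseteq> U" for U
  proof (rule module_basis_span[OF _ U(1)])
    show "module_basis R M (Sum_Type.Plus {1..m} {1..m}) (case_sum u v)"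
      using basis by (simp add: symplectic_basis_def)
    show "case_sum u v ` Sum_Type.Plus {1..m} {1..m} \<subseteq> U" using U(2) by auto
  qed
  have gmem: "g A \<in> carrier (red_module I M)" if "A \<in> carrier (red_module I M)" for A
    using g that by (auto simp: Sp_iff mod_hom_def)
  have gform: "red_form R I h (g A) (g B) = red_form R I h A B"
    if "A \<in> carrier (red_module I M)" "B \<in> carrier (red_module I M)" for A B
    using g that by (simp add: Sp_iff)
  have gadd: "g (A \<oplus>\<^bsub>red_module I M\<^esub> B) = g A \<oplus>\<^bsub>red_module I M\<^esub> g B"
    if "A \<in> carrier (red_module I M)" "B \<in> carrier (red_module I M)" for A B
    using g that by (simp add: Sp_iff mod_hom_def)
  have gsmult: "g (a \<odot>\<^bsub>red_module I M\<^esub> B) = a \<odot>\<^bsub>red_module I M\<^esub> g B"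
    if "a \<in> carrier (R Quot I)" "B \<in> carrier (red_module I M)" for a B
    using g that by (simp add: Sp_iff mod_hom_def)
  have coset: "N +>\<^bsub>M\<^esub> x \<in> carrier (red_module I M)" if "x \<in> carrier M" for x
    using that by (simp add: red_carrier[OF I.is_ideal])
  \<comment> \<open>\<open>r x\<close> is a representative of the image under \<open>g\<close> of the class of \<open>x\<close>; it need not be linear
    in \<open>x\<close>.\<close>
  define r where "r x = (SOME y. y \<in> carrier M \<and> N +>\<^bsub>M\<^esub> y = g (N +>\<^bsub>M\<^esub> x))" for x
  have r: "r x \<in> carrier M \<and> N +>\<^bsub>M\<^esub> r x = g (N +>\<^bsub>M\<^esub> x)" if "x \<in> carrier M" for x
    unfolding r_def
    by (rule someI_ex) (use gmem[OF coset[OF that]] in \<open>auto simp: red_carrier[OF I.is_ideal]\<close>)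
  have r_form: "I +> h (r x) (r y) = I +> h x y" if "x \<in> carrier M" "y \<in> carrier M" for x y
    using gform[OF coset[OF that(1)] coset[OF that(2)]] r[OF that(1)] r[OF that(2)] that
    by (simp add: red_form_coset[OF I.is_ideal bilinear] flip: red_form_coset[OF I.is_ideal bilinear, of "r x" "r y"])
  have "\<exists>u' v'. symplectic_system m u' v' \<and>
    (\<forall>i\<in>{1..m}. N +>\<^bsub>M\<^esub> u' i = N +>\<^bsub>M\<^esub> r (u i) \<and> N +>\<^bsub>M\<^esub> v' i = N +>\<^bsub>M\<^esub> r (v i))"
  proof (rule lift_symplectic_system)
    show "(\<lambda>i. r (u i)) \<in> {1..m} \<rightarrow> carrier M" "(\<lambda>i. r (v i)) \<in> {1..m} \<rightarrow> carrier M"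
      using uv r by auto
    fix i j assume ij: "i \<in> {1..m}" "j \<in> {1..m}"
    have "I +> h (r (u i)) (r (u j)) = I +> \<zero>" "I +> h (r (v i)) (r (v j)) = I +> \<zero>"
      using sys ij by (simp_all add: r_form uv symplectic_system_def)
    then show "h (r (u i)) (r (u j)) \<in> I \<and> h (r (v i)) (r (v j)) \<in> I"
      using r uv ij by (simp add: coset_zero_iff)
    show "I +> h (r (u i)) (r (v j)) = I +> (if i = j then \<one> else \<zero>)"
      using sys ij by (simp add: r_form uv symplectic_system_def)
  qed
  then obtain u' v' where sys': "symplectic_system m u' v'"
    and lift: "\<And>i. i \<in> {1..m} \<Longrightarrow> N +>\<^bsub>M\<^esub> u' i = g (N +>\<^bsub>M\<^esub> u i) \<and> N +>\<^bsub>M\<^esub> v' i = g (N +>\<^bsub>M\<^esub> v i)"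
    using r uv by auto
  have closed: "u \<in> {1..m} \<rightarrow> carrier M" "v \<in> {1..m} \<rightarrow> carrier M"
    "u' \<in> {1..m} \<rightarrow> carrier M" "v' \<in> {1..m} \<rightarrow> carrier M"
    using sys sys' by (simp_all add: symplectic_system_def)
  define X where "X = transfer u v u' v' m"
  have X: "X \<in> mod_hom R M M" unfolding X_def by (rule transfer_mod_hom[OF closed])
  have iso: "h (X x) (X y) = h x y" if "x \<in> carrier M" "y \<in> carrier M" for x y
    unfolding X_def by (rule transfer_isometry[OF closed sys sys' span that])
  have Xc: "X x \<in> carrier M" if "x \<in> carrier M" for x using X that by (auto simp: mod_hom_def)
  have red_X: "N +>\<^bsub>M\<^esub> X x = g (N +>\<^bsub>M\<^esub> x)" if "x \<in> carrier M" for x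
  proof -
    let ?U = "{x \<in> carrier M. N +>\<^bsub>M\<^esub> X x = g (N +>\<^bsub>M\<^esub> x)}"
    have add: "x \<oplus>\<^bsub>M\<^esub> y \<in> ?U" if "x \<in> ?U" "y \<in> ?U" for x y
    proof -
      have "X (x \<oplus>\<^bsub>M\<^esub> y) = X x \<oplus>\<^bsub>M\<^esub> X y" using X that by (simp add: mod_hom_def)
      then show ?thesis using that gadd[OF coset coset, of x y] Xc
        by (simp add: red_add_coset[OF I.is_ideal] flip: red_add_coset[OF I.is_ideal, of "X x" "X y"])
    qed
    have smult: "a \<odot>\<^bsub>M\<^esub> x \<in> ?U" if "a \<in> carrier R" "x \<in> ?U" for a x
    proof -
      have "X (a \<odot>\<^bsub>M\<^esub> x) = a \<odot>\<^bsub>M\<^esub> X x" using X that by (simp add: mod_hom_def)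
      moreover have "I +> a \<in> carrier (R Quot I)" using that by (simp add: Quot_carrier)
      ultimately show ?thesis using that gsmult[OF _ coset, of "I +> a" x] Xc
        by (simp add: red_smult_coset[OF I.is_ideal] flip: red_smult_coset[OF I.is_ideal, of a "X x"])
    qed
    have "?U = carrier M"
    proof (rule span)
      show K: "?K \<subseteq> ?U"
        using uv lift by (auto simp: X_def transfer_basis[OF closed sys])
      show "submodule ?U R M"
      proof (rule submoduleI)
        have "g (N +>\<^bsub>M\<^esub> \<zero>\<^bsub>M\<^esub>) = (I +> \<zero>) \<odot>\<^bsub>red_module I M\<^esub> g (N +>\<^bsub>M\<^esub> \<zero>\<^bsub>M\<^esub>)"
          using gsmult[OF _ coset, of "I +> \<zero>" "\<zero>\<^bsub>M\<^esub>"]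
          by (simp add: Quot_carrier red_smult_coset[OF I.is_ideal])
        also have "\<dots> = N +>\<^bsub>M\<^esub> \<zero>\<^bsub>M\<^esub>"
          using r[of "\<zero>\<^bsub>M\<^esub>"] red_smult_coset[OF I.is_ideal, of \<zero> "r \<zero>\<^bsub>M\<^esub>"] by simp
        finally have "g (N +>\<^bsub>M\<^esub> \<zero>\<^bsub>M\<^esub>) = N +>\<^bsub>M\<^esub> \<zero>\<^bsub>M\<^esub>" .
        moreover have "X \<zero>\<^bsub>M\<^esub> = \<zero>\<^bsub>M\<^esub>"
        proof -
          have "X (\<zero> \<odot>\<^bsub>M\<^esub> \<zero>\<^bsub>M\<^esub>) = \<zero> \<odot>\<^bsub>M\<^esub> X \<zero>\<^bsub>M\<^esub>"
            using X M.zero_closed R.zero_closed unfolding mod_hom_def by blast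
          then show ?thesis using Xc by simp
        qed
        ultimately show "\<zero>\<^bsub>M\<^esub> \<in> ?U" by simp
        show "\<ominus>\<^bsub>M\<^esub> x \<in> ?U" if "x \<in> ?U" for x
          using smult[of "\<ominus> \<one>" x] that by (simp add: smult_l_minus)
      qed (use add smult in auto)
    qed
    then show ?thesis using that by blast
  qed
  have bij: "bij_betw X (carrier M) (carrier M)"
  proof (rule isometry_bij_betw[OF nondeg _ _ span X iso])
    show "finite ?K" "?K \<subseteq> carrier M" using uv by auto
    fix y assume y: "y \<in> carrier M"
    have "g ` carrier (red_module I M) = carrier (red_module I M)"
      using g by (simp add: Sp_iff Bij_def bij_betw_def)
    then have "N +>\<^bsub>M\<^esub> y \<in> g ` carrier (red_module I M)" using coset[OF y] by simp
    then obtain x where "x \<in> carrier M" "N +>\<^bsub>M\<^esub> y = g (N +>\<^bsub>M\<^esub> x)"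
      by (auto simp: red_carrier[OF I.is_ideal])
    then show "\<exists>x\<in>carrier M. N +>\<^bsub>M\<^esub> X x = N +>\<^bsub>M\<^esub> y" using red_X by metis
  qed
  \<comment> \<open>Elements of the symplectic group are extensional functions.\<close>
  let ?X = "restrict X (carrier M)"
  have X': "?X \<in> mod_hom R M M" using X Xc by (simp add: mod_hom_def)
  have "?X \<in> carrier (Sp R M h)"
    using bij X' iso by (simp add: Sp_iff Bij_def cong: bij_betw_cong)
  moreover have "red_map I M ?X = g"
  proof (rule extensionalityI[of _ "carrier (red_module I M)"])
    show "g \<in> extensional (carrier (red_module I M))" using g by (simp add: Sp_iff Bij_def)
    fix A assume "A \<in> carrier (red_module I M)"
    then obtain x where x: "x \<in> carrier M" "A = N +>\<^bsub>M\<^esub> x" by (auto simp: red_carrier[OF I.is_ideal])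
    show "red_map I M ?X A = g A"
      using x(1) red_X[OF x(1)] by (simp add: x(2) red_map_coset[OF I.is_ideal X'])
  qed (simp add: red_map_def)
  ultimately show ?thesis by blast
qed

theorem theorem10p3:
  fixes S :: "('a, 'r) ring_scheme" and V :: "('a, 'v, 'w) module_scheme"
    and h :: "'v \<Rightarrow> 'v \<Rightarrow> 'a" and I :: "'a set" and m :: nat
  assumes "local_ring S"
    and "m \<ge> 1"
    and "module S V" and "free_of_rank S V (2 * m)"
    and "alternating_form S V h" and "nondegenerate_form S V h"
    and "\<exists>u v. symplectic_basis S V h m u v"
    and "ideal I S" and "I \<noteq> carrier S"
  shows "red_map I V \<in> epi (Sp S V h) (Sp (S Quot I) (red_module I V) (red_form S I h))"
proof -
  interpret alternating_module S V h
    using assms(3,5) by (simp add: alternating_module_def alternating_module_axioms_def)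
  interpret radical_reduction S V h I
  proof (intro radical_reduction.intro radical_reduction_axioms.intro)
    show "\<one>\<^bsub>S\<^esub> \<oplus>\<^bsub>S\<^esub> i \<in> Units S" if "i \<in> I" for i
      using local_ring.one_plus_proper_ideal_unit[OF assms(1,8,9) that] .
  qed (rule alternating_module_axioms, rule assms(8))
  show ?thesis
    unfolding epi_iff_subset
    using red_map_hom[OF assms(8)] red_map_surj[OF assms(6)] assms(7) by blast
qed

end
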